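(* Let $n\ge2$, let $p$ be a polynomial of degree $d=\kappa n$ with $\kappa$ a positive integer, and let $\dot p$ be a polynomial of degree strictly less than $\deg p-1$. Let $\Omega=\sum_{i=1}^{n-1}\sum_{j=-i}^{i}\omega_{i,j}v_{i,j}$, with holomorphic coefficient functions $\omega_{i,j}(z)$ on $\mathbb{C}$, be a solution of the isomonodromy equation $$\frac{d\Omega}{dz}=\dot p\,f_{n-1}+[\tilde e,\Omega]+p\,[f_{n-1},\Omega].$$ For $1\le i\le n-2$, consider the integers $j$ with $0\le j\le i$ such that $c_{i,j,j}\ne0$. Let $m_i\le i$ be the number of such integers and enumerate them in decreasing order as $i\ge j_{i,1}>j_{i,2}>\dots>j_{i,m_i}\ge0$. Then $$\omega_{i,i}^{(2i+1)}=\sum_{\ell=1}^{m_i}\pm W_{i-j_{i,\ell}}\big(p,\omega_{n-1-j_{i,\ell},\,n-1-j_{i,\ell}}\big).$$ For $i=n-1$, let likewise $j_{n-1,1}>\dots>j_{n-1,m_{n-1}}\ge 0$ be the decreasing enumeration of the integers $j$ with $0\le j\le n-2$ and $c_{n-1,j,j}\neq 0$. Then $j_{n-1,1}=n-2$ and $$\omega_{n-1,n-1}^{(2n-1)}=\dot p+W_1(p,\omega_{1,1})+\sum_{\ell=2}^{m_{n-1}}\pm W_{n-1-j_{n-1,\ell}}\big(p,\omega_{n-1-j_{n-1,\ell},\,n-1-j_{n-1,\ell}}\big).$$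
   Context: **Basis of $\mathfrak{sl}(n,\mathbb{C})$.** Let $\tilde e$ be the $n\times n$ matrix with first superdiagonal $(1,2,\dots,n-1)$ and zeros elsewhere, $\tilde f$ the matrix with first subdiagonal $(n-1,n-2,\dots,1)$ and zeros elsewhere, and $\tilde h=\mathrm{diag}(n-1,n-3,\dots,-(n-1))$; they form an $\mathfrak{sl}_2$-triple with $[\tilde e,\tilde f]=\tilde h$. Let $S(j)$ be the $2j$-eigenspace of $\mathrm{ad}_{\tilde h}$ (matrices supported on the $j$-th off-diagonal; superdiagonal for $j>0$, subdiagonal for $j<0$). For $1\le i\le n-1$ let $f_i$ be the unique element of $S(-i)\cap\ker\mathrm{ad}_{\tilde f}$ whose non-zero entries are positive integers, the least of which is $1$. In particular $f_1=\tilde f$ and $f_{n-1}$ is the matrix whose only non-zero entry is a $1$ in row $n$, column $1$. For $1\le i\le n-1$, $-i\le j\le i$ put $v_{i,j}=(\mathrm{ad}_{\tilde e})^{i+j}f_i\in S(j)$. The $v_{i,j}$ form a basis of $\mathfrak{sl}(n,\mathbb{C})$. **Structure constants.** For $0\le k\le j\le n-1$, $k\ne n-1$, the rational numbers $c_{i,j,k}$ (for $\max(1,j)\le i\le n-1$) are defined by $$[f_{n-1},v_{n-1-k,\,n-1-j}]=\sum_{i=\max(1,j)}^{n-1}c_{i,j,k}\,v_{i,-j}.$$ **Weight expressions.** For functions $f,g$ and an integer $k\ge0$, $W_k(f,g)$ ("a weight $k$ expression in $f$ and $g$") denotes any linear combination $\sum_{j=0}^kc_jf^{(k-j)}g^{(j)}$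 whose coefficients $c_j$ are non-negative real constants, at least one of which is non-zero. Each occurrence of the symbol may stand for a different linear combination, and an equation containing such symbols asserts that it holds for some choice of such coefficients; $\pm$ denotes, for each term, some choice of sign. *)

theory Defs
  imports
    "HOL-Complex_Analysis.Complex_Analysis"
    "HOL-Computational_Algebra.Computational_Algebra"
    "Jordan_Normal_Form.Matrix"
begin

text \<open>
  Matrices are those of Jordan Normal Form, so that n is an ordinary natural number. Rows and
  columns are numbered from 0: entry \<open>(a, b)\<close> here is the entry in row \<open>a + 1\<close> and column
  \<open>b + 1\<close> of the mathematical text.
\<close>

definition ad :: "complex mat \<Rightarrow> complex mat \<Rightarrow> complex mat" where
  "ad A B = A * B - B * A"

text \<open>Matrices do not form a monoid type class, so finite sums are taken entrywise.\<close>

definition mat_sum :: "nat \<Rightarrow> ('i \<Rightarrow> complex mat) \<Rightarrow> 'i set \<Rightarrow> complex mat" where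
  "mat_sum n M I = Matrix.mat n n (\<lambda>(a, b). \<Sum>i\<in>I. M i $$ (a, b))"

definition sl :: "nat \<Rightarrow> complex mat set" where
  "sl n = {A \<in> carrier_mat n n. (\<Sum>a<n. A $$ (a, a)) = 0}"

definition e_mat :: "nat \<Rightarrow> complex mat" where
  "e_mat n = Matrix.mat n n (\<lambda>(a, b). if b = a + 1 then of_nat (a + 1) else 0)"

definition f_mat :: "nat \<Rightarrow> complex mat" where
  "f_mat n = Matrix.mat n n (\<lambda>(a, b). if a = b + 1 then of_nat (n - 1 - b) else 0)"

definition h_mat :: "nat \<Rightarrow> complex mat" where
  "h_mat n = Matrix.mat n n (\<lambda>(a, b). if a = b then of_int (int n - 1 - 2 * int a) else 0)"

definition S_space :: "nat \<Rightarrow> int \<Rightarrow> complex mat set" where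
  "S_space n j = {A \<in> sl n. ad (h_mat n) A = of_int (2 * j) \<cdot>\<^sub>m A}"

definition nonzero_entries :: "complex mat \<Rightarrow> complex set" where
  "nonzero_entries A = {A $$ (a, b) | a b. a < dim_row A \<and> b < dim_col A \<and> A $$ (a, b) \<noteq> 0}"

text \<open>The last two conjuncts say that the non-zero entries are positive integers of which the
  least is 1.\<close>

definition f_elt :: "nat \<Rightarrow> nat \<Rightarrow> complex mat" where
  "f_elt n i = (THE A. A \<in> S_space n (- int i) \<and> ad (f_mat n) A = 0\<^sub>m n n \<and>
      (\<forall>x\<in>nonzero_entries A. \<exists>m::nat. m \<ge> 1 \<and> x = of_nat m) \<and> 1 \<in> nonzero_entries A)"

definition v_elt :: "nat \<Rightarrow> nat \<Rightarrow> int \<Rightarrow> complex mat" where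
  "v_elt n i j = (ad (e_mat n) ^^ nat (int i + j)) (f_elt n i)"

text \<open>
  The coefficients \<open>c\<^sub>i\<^sub>,\<^sub>j\<^sub>,\<^sub>k\<close>, meaningful for \<open>0 \<le> k \<le> j \<le> n - 1\<close>, \<open>k \<noteq> n - 1\<close> and
  \<open>max 1 j \<le> i \<le> n - 1\<close>. The family of coefficients for fixed j and k is extended by 0 in i, which
  makes it unique as a function of i.
\<close>

definition struct_const :: "nat \<Rightarrow> nat \<Rightarrow> nat \<Rightarrow> nat \<Rightarrow> rat" where
  "struct_const n i j k =
     (THE c. (\<forall>l. l \<notin> {max 1 j..n - 1} \<longrightarrow> c l = 0) \<and>
        ad (f_elt n (n - 1)) (v_elt n (n - 1 - k) (int n - 1 - int j)) =
          mat_sum n (\<lambda>l. of_rat (c l) \<cdot>\<^sub>m v_elt n l (- int j)) {max 1 j..n - 1}) i"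

definition weight_expr ::
    "nat \<Rightarrow> (complex \<Rightarrow> complex) \<Rightarrow> (complex \<Rightarrow> complex) \<Rightarrow> (complex \<Rightarrow> complex) \<Rightarrow> bool" where
  "weight_expr k f g w \<longleftrightarrow>
     (\<exists>c :: nat \<Rightarrow> real. (\<forall>j\<le>k. c j \<ge> 0) \<and> (\<exists>j\<le>k. c j \<noteq> 0) \<and>
        w = (\<lambda>z. \<Sum>j\<le>k. of_real (c j) * (deriv ^^ (k - j)) f z * (deriv ^^ j) g z))"

definition Omega_mat :: "nat \<Rightarrow> (nat \<Rightarrow> int \<Rightarrow> complex \<Rightarrow> complex) \<Rightarrow> complex \<Rightarrow> complex mat" where
  "Omega_mat n \<omega> z =
     mat_sum n (\<lambda>i. mat_sum n (\<lambda>j. \<omega> i j z \<cdot>\<^sub>m v_elt n i j) {- int i..int i}) {1..n - 1}"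

definition mat_has_deriv ::
    "nat \<Rightarrow> (complex \<Rightarrow> complex mat) \<Rightarrow> complex mat \<Rightarrow> complex \<Rightarrow> bool" where
  "mat_has_deriv n F D z \<longleftrightarrow>
     (\<forall>a<n. \<forall>b<n. ((\<lambda>w. F w $$ (a, b)) has_field_derivative D $$ (a, b)) (at z))"

text \<open>In the next definition pd stands for the polynomial written as p with a dot.\<close>

definition isomonodromy_solution ::
    "nat \<Rightarrow> complex poly \<Rightarrow> complex poly \<Rightarrow> (complex \<Rightarrow> complex mat) \<Rightarrow> bool" where
  "isomonodromy_solution n p pd \<Omega> \<longleftrightarrow>
     (\<forall>z. mat_has_deriv n \<Omega>
        (poly pd z \<cdot>\<^sub>m f_elt n (n - 1) + ad (e_mat n) (\<Omega> z)
           + poly p z \<cdot>\<^sub>m ad (f_elt n (n - 1)) (\<Omega> z)) z)"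

text \<open>The bound \<open>j \<le> n - 2\<close> only matters for \<open>i = n - 1\<close>.\<close>

definition nz_indices :: "nat \<Rightarrow> nat \<Rightarrow> nat set" where
  "nz_indices n i = {j. j \<le> i \<and> j \<le> n - 2 \<and> struct_const n i j j \<noteq> 0}"

definition m_num :: "nat \<Rightarrow> nat \<Rightarrow> nat" where
  "m_num n i = card (nz_indices n i)"

text \<open>The decreasing enumeration of \<open>nz_indices n i\<close>, numbered from 1 to \<open>m_num n i\<close>.\<close>

definition j_idx :: "nat \<Rightarrow> nat \<Rightarrow> nat \<Rightarrow> nat" where
  "j_idx n i l = rev (sorted_list_of_set (nz_indices n i)) ! (l - 1)"

end

theory Submission
  imports Defs
begin

text \<open>
  The commutator with \<open>f\<close> sends \<open>v\<^sub>i\<^sub>,\<^sub>j\<close> to \<open>(i + j)(i - j + 1) v\<^sub>i\<^sub>,\<^sub>j\<^sub>-\<^sub>1\<close> and kills \<open>f\<^sub>n\<^sub>-\<^sub>1\<close>.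
  Applied to the defining relation of the structure constants it gives
  \<open>(2n - 2 - k - J)(J - k + 1) c\<^sub>i\<^sub>,\<^sub>J\<^sub>+\<^sub>1\<^sub>,\<^sub>k = (i - J)(i + J + 1) c\<^sub>i\<^sub>,\<^sub>J\<^sub>,\<^sub>k\<close>, so for fixed \<open>i\<close> and \<open>k\<close> all
  \<open>c\<^sub>i\<^sub>,\<^sub>J\<^sub>,\<^sub>k\<close> with \<open>k \<le> J \<le> i\<close> are positive multiples of \<open>c\<^sub>i\<^sub>,\<^sub>k\<^sub>,\<^sub>k\<close>. Comparing coefficients in the
  isomonodromy equation expresses \<open>\<omega>\<^sub>i\<^sub>,\<^sub>j'\<close> through \<open>\<omega>\<^sub>i\<^sub>,\<^sub>j\<^sub>-\<^sub>1\<close> and terms \<open>p c\<^sub>i\<^sub>,\<^sub>J\<^sub>,\<^sub>k \<omega>\<^sub>n\<^sub>-\<^sub>1\<^sub>-\<^sub>k\<^sub>,\<^sub>n\<^sub>-\<^sub>1\<^sub>-\<^sub>J\<close>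
  with \<open>J = -j\<close>; iterating and expanding by the Leibniz rule, the terms with the same \<open>k\<close> have
  coefficients of one sign and add up to a weight expression. Finally \<open>c\<^sub>i\<^sub>,\<^sub>i\<^sub>,\<^sub>i = 0\<close> by pairing with
  \<open>e\<^sup>i\<close> under the trace form, and \<open>c\<^sub>n\<^sub>-\<^sub>1\<^sub>,\<^sub>n\<^sub>-\<^sub>2\<^sub>,\<^sub>n\<^sub>-\<^sub>2 = 2\<close> because \<open>v\<^sub>1\<^sub>,\<^sub>1 = -2e\<close>.
\<close>

subsection \<open>Commutators of matrices and weights\<close>

lemma ad_carrier [simp]:
  "A \<in> carrier_mat n n \<Longrightarrow> B \<in> carrier_mat n n \<Longrightarrow> ad A B \<in> carrier_mat n n"
  by (auto simp: ad_def)

lemma e_mat_carrier [simp]: "e_mat n \<in> carrier_mat n n"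
  and f_mat_carrier [simp]: "f_mat n \<in> carrier_mat n n"
  and h_mat_carrier [simp]: "h_mat n \<in> carrier_mat n n"
  by (auto simp: e_mat_def f_mat_def h_mat_def)

lemma mult_mat_index:
  fixes A B :: "'a :: semiring_0 mat"
  assumes "A \<in> carrier_mat n n" "B \<in> carrier_mat n n" "a < n" "b < n"
  shows "(A * B) $$ (a, b) = (\<Sum>c<n. A $$ (a, c) * B $$ (c, b))"
  using assms by (auto simp: scalar_prod_def atLeast0LessThan intro!: sum.cong)

lemma ad_index:
  assumes "A \<in> carrier_mat n n" "B \<in> carrier_mat n n" "a < n" "b < n"
  shows "ad A B $$ (a, b) = (\<Sum>c<n. A $$ (a, c) * B $$ (c, b)) - (\<Sum>c<n. B $$ (a, c) * A $$ (c, b))"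
proof -
  have "ad A B $$ (a, b) = (A * B) $$ (a, b) - (B * A) $$ (a, b)"
    using assms unfolding ad_def by (subst index_minus_mat(1)) auto
  with assms show ?thesis by (simp only: mult_mat_index)
qed

lemma mat_sum_carrier [simp]: "mat_sum n M I \<in> carrier_mat n n"
  by (simp add: mat_sum_def)

lemma mat_sum_index [simp]:
  "a < n \<Longrightarrow> b < n \<Longrightarrow> mat_sum n M I $$ (a, b) = (\<Sum>i\<in>I. M i $$ (a, b))"
  by (simp add: mat_sum_def)

lemma mat_sum_cong:
  "I = J \<Longrightarrow> (\<And>i. i \<in> J \<Longrightarrow> M i = N i) \<Longrightarrow> mat_sum n M I = mat_sum n N J"
  by (auto simp: mat_sum_def intro!: sum.cong)

lemma mat_sum_singleton: "M i \<in> carrier_mat n n \<Longrightarrow> mat_sum n M {i} = M i"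
  by (intro eq_matI) (auto simp: mat_sum_def)

lemma ad_mat_sum:
  assumes "A \<in> carrier_mat n n" "\<And>i. i \<in> I \<Longrightarrow> M i \<in> carrier_mat n n"
  shows "ad A (mat_sum n M I) = mat_sum n (\<lambda>i. ad A (M i)) I"
proof (rule eq_matI)
  fix a b assume "a < dim_row (mat_sum n (\<lambda>i. ad A (M i)) I)" "b < dim_col (mat_sum n (\<lambda>i. ad A (M i)) I)"
  then have ab: "a < n" "b < n" by (auto simp: mat_sum_def)
  have "ad A (mat_sum n M I) $$ (a, b)
      = (\<Sum>c<n. \<Sum>i\<in>I. A $$ (a, c) * M i $$ (c, b)) - (\<Sum>c<n. \<Sum>i\<in>I. M i $$ (a, c) * A $$ (c, b))"
    using assms ab by (simp add: ad_index sum_distrib_left sum_distrib_right)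
  also have "\<dots> = (\<Sum>i\<in>I. ad A (M i) $$ (a, b))"
    using assms ab by (subst (1 2) sum.swap) (simp add: ad_index sum_subtractf)
  finally show "ad A (mat_sum n M I) $$ (a, b) = mat_sum n (\<lambda>i. ad A (M i)) I $$ (a, b)"
    using ab by simp
qed (use assms in \<open>auto simp: mat_sum_def ad_def\<close>)

lemma ad_smult:
  assumes "A \<in> carrier_mat n n" "B \<in> carrier_mat n n"
  shows "ad A (x \<cdot>\<^sub>m B) = x \<cdot>\<^sub>m ad A B"
  by (rule eq_matI) (use assms in \<open>auto simp: ad_index sum_distrib_left algebra_simps ad_def\<close>)

lemma ad_zero_right [simp]: "A \<in> carrier_mat n n \<Longrightarrow> ad A (0\<^sub>m n n) = 0\<^sub>m n n"
  by (rule eq_matI) (auto simp: ad_def)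

lemma ad_add:
  assumes "A \<in> carrier_mat n n" "B \<in> carrier_mat n n" "C \<in> carrier_mat n n"
  shows "ad A (B + C) = ad A B + ad A C"
  by (rule eq_matI) (use assms in \<open>auto simp: ad_index sum.distrib algebra_simps ad_def
        simp del: index_mult_mat(1)\<close>)

lemma ad_skew:
  assumes "A \<in> carrier_mat n n" "B \<in> carrier_mat n n"
  shows "ad A B = (-1) \<cdot>\<^sub>m ad B A"
  by (rule eq_matI) (use assms in \<open>auto simp: ad_def simp del: index_mult_mat(1)\<close>)

text \<open>Both sides expand into signed sums of the six triple products of \<open>A\<close>,
  \<open>B\<close> and \<open>C\<close>, and these sums agree entry by entry.\<close>

lemma ad_jacobi:
  assumes A: "A \<in> carrier_mat n n" and B: "B \<in> carrier_mat n n" and C: "C \<in> carrier_mat n n"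
  shows "ad A (ad B C) = ad (ad A B) C + ad B (ad A C)"
proof -
  have m: "X * Y \<in> carrier_mat n n" if "X \<in> carrier_mat n n" "Y \<in> carrier_mat n n" for X Y :: "complex mat"
    using that by simp
  have dist: "(X - Y) * Z = X * Z - Y * Z" "Z * (X - Y) = Z * X - Z * Y" "(X * Y) * Z = X * (Y * Z)"
    if "X \<in> carrier_mat n n" "Y \<in> carrier_mat n n" "Z \<in> carrier_mat n n" for X Y Z :: "complex mat"
    using that by (auto intro!: minus_mult_distrib_mat mult_minus_distrib_mat assoc_mult_mat)
  have e: "ad X (ad Y Z) = X * (Y * Z) - X * (Z * Y) - (Y * (Z * X) - Z * (Y * X))"
    "ad (ad X Y) Z = X * (Y * Z) - Y * (X * Z) - (Z * (X * Y) - Z * (Y * X))"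
    if X: "X \<in> carrier_mat n n" and Y: "Y \<in> carrier_mat n n" and Z: "Z \<in> carrier_mat n n" for X Y Z
    by (simp_all only: ad_def dist m X Y Z)
  \<comment> \<open>\<open>X1\<close> to \<open>X6\<close> stand for the triple products in the
    orders ABC, ACB, BCA, CBA, BAC, CAB.\<close>
  have "X1 - X2 - (X3 - X4) = X1 - X5 - (X6 - X4) + (X5 - X3 - (X2 - X6))"
    if "X1 \<in> carrier_mat n n" "X2 \<in> carrier_mat n n" "X3 \<in> carrier_mat n n" "X4 \<in> carrier_mat n n"
      "X5 \<in> carrier_mat n n" "X6 \<in> carrier_mat n n" for X1 X2 X3 X4 X5 X6 :: "complex mat"
    by (rule eq_matI) (use that in auto)
  from this[of "A * (B * C)" "A * (C * B)" "B * (C * A)" "C * (B * A)" "B * (A * C)" "C * (A * B)"]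
  show ?thesis
    by (simp only: e A B C m simp_thms)
qed

section \<open>Matrices supported on one diagonal\<close>

text \<open>This is the 2j-eigenspace of \<open>ad (h_mat n)\<close> among all n by n matrices;
  \<open>S_space\<close> adds trace zero, a constraint only for j = 0.\<close>

definition of_weight :: "nat \<Rightarrow> int \<Rightarrow> complex mat \<Rightarrow> bool" where
  "of_weight n j A \<longleftrightarrow> A \<in> carrier_mat n n \<and>
     (\<forall>a<n. \<forall>b<n. A $$ (a, b) \<noteq> 0 \<longrightarrow> int b - int a = j)"

lemma of_weight_carrier: "of_weight n j A \<Longrightarrow> A \<in> carrier_mat n n"
  by (simp add: of_weight_def)

lemma of_weight_index: "of_weight n j A \<Longrightarrow> a < n \<Longrightarrow> b < n \<Longrightarrow> int b - int a \<noteq> j \<Longrightarrow> A $$ (a, b) = 0"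
  by (auto simp: of_weight_def)

text \<open>In both products the entry (a, b) passes through some c, and b - a = (c - a) + (b - c)
  must then be the sum of the two weights.\<close>

lemma of_weight_ad:
  assumes "of_weight n i A" "of_weight n j B"
  shows "of_weight n (i + j) (ad A B)"
  unfolding of_weight_def
proof (intro conjI allI impI)
  show "ad A B \<in> carrier_mat n n" using assms by (simp add: of_weight_carrier)
  fix a b assume ab: "a < n" "b < n" and nz: "ad A B $$ (a, b) \<noteq> 0"
  show "int b - int a = i + j"
  proof (rule ccontr)
    assume ne: "int b - int a \<noteq> i + j"
    have 1: "A $$ (a, c) * B $$ (c, b) = 0" "B $$ (a, c) * A $$ (c, b) = 0" if "c < n" for c
    proof -
      have "int c - int a \<noteq> i \<or> int b - int c \<noteq> j" "int c - int a \<noteq> j \<or> int b - int c \<noteq> i"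
        using ne by linarith+
      then show "A $$ (a, c) * B $$ (c, b) = 0" "B $$ (a, c) * A $$ (c, b) = 0"
        using of_weight_index[OF assms(1) \<open>a < n\<close> that] of_weight_index[OF assms(2) that \<open>b < n\<close>]
          of_weight_index[OF assms(2) \<open>a < n\<close> that] of_weight_index[OF assms(1) that \<open>b < n\<close>]
        by auto
    qed
    have "ad A B $$ (a, b) = 0"
      using assms ab 1 by (simp only: ad_index[OF of_weight_carrier of_weight_carrier])
        (simp add: sum.neutral del: mult_eq_0_iff)
    with nz show False by simp
  qed
qed

lemma of_weight_e [simp]: "of_weight n 1 (e_mat n)"
  and of_weight_f [simp]: "of_weight n (-1) (f_mat n)"
  by (auto simp: of_weight_def e_mat_def f_mat_def)

lemma of_weight_mat_sum:
  assumes "\<And>i. i \<in> I \<Longrightarrow> of_weight n j (M i)"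
  shows "of_weight n j (mat_sum n M I)"
  unfolding of_weight_def
proof (intro conjI allI impI)
  fix a b assume ab: "a < n" "b < n" and "mat_sum n M I $$ (a, b) \<noteq> 0"
  then obtain i where "i \<in> I" "M i $$ (a, b) \<noteq> 0"
    by (auto dest: sum.not_neutral_contains_not_neutral)
  then show "int b - int a = j" using assms ab by (auto simp: of_weight_def)
qed simp

lemma of_weight_smult: "of_weight n j A \<Longrightarrow> of_weight n j (x \<cdot>\<^sub>m A)"
  by (auto simp: of_weight_def)

lemma of_weight_add: "of_weight n j A \<Longrightarrow> of_weight n j B \<Longrightarrow> of_weight n j (A + B)"
  unfolding of_weight_def by (auto simp: of_weight_def) (metis add.right_neutral)

lemma of_weight_zero [simp]: "of_weight n j (0\<^sub>m n n)"
  by (auto simp: of_weight_def)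

lemma of_weight_eqI:
  assumes "of_weight n j A" "of_weight n j B"
    and "\<And>a b. a < n \<Longrightarrow> b < n \<Longrightarrow> int b - int a = j \<Longrightarrow> A $$ (a, b) = B $$ (a, b)"
  shows "A = B"
proof (rule eq_matI)
  fix a b assume "a < dim_row B" "b < dim_col B"
  then have "a < n" "b < n" using assms by (auto simp: of_weight_def)
  then show "A $$ (a, b) = B $$ (a, b)" 
    using assms by (cases "int b - int a = j") (auto simp: of_weight_index)
qed (use assms in \<open>auto simp: of_weight_def\<close>)

lemma ad_h_index:
  assumes "A \<in> carrier_mat n n" "a < n" "b < n"
  shows "ad (h_mat n) A $$ (a, b) = of_int (2 * (int b - int a)) * A $$ (a, b)"
proof -
  have "(\<Sum>c<n. h_mat n $$ (a, c) * A $$ (c, b)) = of_int (int n - 1 - 2 * int a) * A $$ (a, b)"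
    using assms by (subst sum.remove[of _ a]) (auto simp: h_mat_def intro!: sum.neutral)
  moreover have "(\<Sum>c<n. A $$ (a, c) * h_mat n $$ (c, b)) = of_int (int n - 1 - 2 * int b) * A $$ (a, b)"
    using assms by (subst sum.remove[of _ b]) (auto simp: h_mat_def intro!: sum.neutral)
  ultimately show ?thesis
    using assms by (simp only: ad_index[OF h_mat_carrier]) (simp add: algebra_simps)
qed

lemma ad_h_of_weight:
  assumes "of_weight n j A"
  shows "ad (h_mat n) A = of_int (2 * j) \<cdot>\<^sub>m A"
proof (rule eq_matI)
  fix a b assume "a < dim_row (of_int (2 * j) \<cdot>\<^sub>m A)" "b < dim_col (of_int (2 * j) \<cdot>\<^sub>m A)"
  then have "a < n" "b < n" "a < dim_row A" "b < dim_col A" using assms by (auto simp: of_weight_def)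
  then show "ad (h_mat n) A $$ (a, b) = (of_int (2 * j) \<cdot>\<^sub>m A) $$ (a, b)" 
    using assms
    by (cases "int b - int a = j") (auto simp: of_weight_index ad_h_index of_weight_carrier)
qed (use assms in \<open>auto simp: of_weight_def ad_def h_mat_def\<close>)

text \<open>\<open>ad (h_mat n)\<close> multiplies the entry (a, b) by 2(b - a), so an eigenvector
  for 2j vanishes off the j-th diagonal.\<close>

lemma S_space_iff:
  "A \<in> S_space n j \<longleftrightarrow> of_weight n j A \<and> (\<Sum>a<n. A $$ (a, a)) = 0"
proof
  assume A: "A \<in> S_space n j"
  have "int b - int a = j" if "a < n" "b < n" "A $$ (a, b) \<noteq> 0" for a b
  proof -
    from A have "ad (h_mat n) A $$ (a, b) = of_int (2 * j) * A $$ (a, b)"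
      using that by (auto simp: S_space_def sl_def)
    moreover have "ad (h_mat n) A $$ (a, b) = of_int (2 * (int b - int a)) * A $$ (a, b)"
      using A that by (intro ad_h_index) (auto simp: S_space_def sl_def)
    ultimately have "(of_int (2 * (int b - int a)) :: complex) = of_int (2 * j)" using that by simp
    then show ?thesis by (subst (asm) of_int_eq_iff) simp
  qed
  with A show "of_weight n j A \<and> (\<Sum>a<n. A $$ (a, a)) = 0"
    by (auto simp: S_space_def sl_def of_weight_def)
qed (auto simp: S_space_def sl_def ad_h_of_weight of_weight_carrier)

lemma trace_ad:
  assumes "A \<in> carrier_mat n n" "B \<in> carrier_mat n n"
  shows "(\<Sum>a<n. ad A B $$ (a, a)) = 0"
proof -
  have "(\<Sum>a<n. ad A B $$ (a, a)) = (\<Sum>a<n. \<Sum>c<n. A $$ (a, c) * B $$ (c, a)) - (\<Sum>a<n. \<Sum>c<n. B $$ (a, c) * A $$ (c, a))"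
    using assms by (simp add: ad_index sum_subtractf)
  also have "(\<Sum>a<n. \<Sum>c<n. B $$ (a, c) * A $$ (c, a)) = (\<Sum>a<n. \<Sum>c<n. A $$ (a, c) * B $$ (c, a))"
    by (subst sum.swap) (simp add: mult.commute)
  finally show ?thesis by simp
qed

text \<open>The diagonal entry at a is (a + 1)(n - 1 - a) - (n - a)a = n - 1 - 2a.\<close>

lemma ad_e_f: "ad (e_mat n) (f_mat n) = h_mat n"
proof (rule of_weight_eqI)
  show "of_weight n 0 (ad (e_mat n) (f_mat n))"
    using of_weight_ad[OF of_weight_e of_weight_f] by simp
  show "of_weight n 0 (h_mat n)" by (auto simp: of_weight_def h_mat_def)
  fix a b assume ab: "a < n" "b < n" "int b - int a = 0"
  have 1: "(\<Sum>c<n. e_mat n $$ (a, c) * f_mat n $$ (c, a)) = of_nat (a + 1) * of_nat (n - 1 - a)"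
  proof (cases "a + 1 < n")
    case True
    then show ?thesis using ab by (subst sum.remove[of _ "a + 1"]) (auto simp: e_mat_def f_mat_def)
  qed (use ab in \<open>auto simp: e_mat_def f_mat_def intro!: sum.neutral\<close>)
  have 2: "(\<Sum>c<n. f_mat n $$ (a, c) * e_mat n $$ (c, a)) = of_nat (n - a) * of_nat a"
  proof (cases "a \<ge> 1")
    case True
    then show ?thesis using ab
      by (subst sum.remove[of _ "a - 1"]) (auto simp: e_mat_def f_mat_def of_nat_diff intro!: sum.neutral split: if_splits)
  qed (use ab in \<open>auto simp: e_mat_def f_mat_def intro!: sum.neutral\<close>)
  show "ad (e_mat n) (f_mat n) $$ (a, b) = h_mat n $$ (a, b)"
  proof -
    have "b = a" using ab by simp
    moreover have "ad (e_mat n) (f_mat n) $$ (a, a) = h_mat n $$ (a, a)"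
      using ab by (simp only: ad_index[OF e_mat_carrier f_mat_carrier] 1 2)
        (simp add: h_mat_def of_nat_diff algebra_simps)
    ultimately show ?thesis by simp
  qed
qed

text \<open>Each row and each column of f has at most one non-zero entry; the guards treat the first
  row and the last column, where a neighbour is missing.\<close>

lemma ad_f_index:
  assumes "A \<in> carrier_mat n n" "a < n" "b < n"
  shows "ad (f_mat n) A $$ (a, b) =
     (if a \<ge> 1 then of_nat (n - a) * A $$ (a - 1, b) else 0)
      - (if b + 1 < n then A $$ (a, b + 1) * of_nat (n - 1 - b) else 0)"
proof -
  have 1: "(\<Sum>c<n. f_mat n $$ (a, c) * A $$ (c, b)) = (if a \<ge> 1 then of_nat (n - a) * A $$ (a - 1, b) else 0)"
  proof (cases "a \<ge> 1")
    case True
    then show ?thesis using assms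
      by (subst sum.remove[of _ "a - 1"]) (auto simp: f_mat_def of_nat_diff intro!: sum.neutral split: if_splits)
  qed (use assms in \<open>auto simp: f_mat_def intro!: sum.neutral\<close>)
  have 2: "(\<Sum>c<n. A $$ (a, c) * f_mat n $$ (c, b)) = (if b + 1 < n then A $$ (a, b + 1) * of_nat (n - 1 - b) else 0)"
  proof (cases "b + 1 < n")
    case True
    then show ?thesis using assms
      by (subst sum.remove[of _ "b + 1"]) (auto simp: f_mat_def of_nat_diff intro!: sum.neutral split: if_splits)
  qed (use assms in \<open>auto simp: f_mat_def intro!: sum.neutral\<close>)
  show ?thesis using assms by (simp only: ad_index[OF f_mat_carrier] 1 2)
qed

subsection \<open>Strings of vectors under the adjoint action\<close>

text \<open>Explicit form of \<open>f_elt n i\<close>, see \<open>f_elt_eq\<close>. For i = 0 it is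
  the identity matrix, which occurs in \<open>v_elt_span\<close>.\<close>

definition binom_mat :: "nat \<Rightarrow> nat \<Rightarrow> complex mat" where
  "binom_mat n i = Matrix.mat n n (\<lambda>(a, b). if a = b + i then of_nat ((n - 1 - b) choose i) else 0)"

lemma of_weight_binom_mat: "of_weight n (- int i) (binom_mat n i)"
  by (auto simp: of_weight_def binom_mat_def)

lemma binom_mat_carrier [simp]: "binom_mat n i \<in> carrier_mat n n"
  by (simp add: binom_mat_def)

text \<open>With m = n - 1 - b this is the absorption identity (m - i) C(m, i) = m C(m - 1,
  i).\<close>

lemma ad_f_binom_mat: "ad (f_mat n) (binom_mat n i) = 0\<^sub>m n n"
proof (rule of_weight_eqI)
  show "of_weight n (- int (i + 1)) (ad (f_mat n) (binom_mat n i))"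
    using of_weight_ad[OF of_weight_f of_weight_binom_mat, of n i] by (simp add: algebra_simps)
  show "of_weight n (- int (i + 1)) (0\<^sub>m n n)" by simp
  fix a b assume ab: "a < n" "b < n" and "int b - int a = - int (i + 1)"
  then have a: "a = b + i + 1" by simp
  have "of_nat (n - 1 - b - i) * of_nat ((n - 1 - b) choose i)
      = (of_nat (n - 1 - b) * of_nat ((n - 1 - b - 1) choose i) :: complex)"
    using binomial_absorb_comp[of "n - 1 - b" i] by (simp flip: of_nat_mult)
  moreover have "n - a = n - 1 - b - i" "n - 1 - (b + 1) = n - 1 - b - 1" "b + 1 < n" using a ab by auto
  ultimately have "ad (f_mat n) (binom_mat n i) $$ (a, b) = 0"
    using ab a by (simp add: ad_f_index binom_mat_def)
  then show "ad (f_mat n) (binom_mat n i) $$ (a, b) = 0\<^sub>m n n $$ (a, b)" using ab by simp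
qed

text \<open>[f, A] = 0 links neighbouring entries of the diagonal by non-zero factors. Climbing from
  the last row, each entry is fixed by the one before it, so the kernel in this weight is a
  line.\<close>

lemma ker_ad_f_lower:
  assumes A: "of_weight n (- int i) A" and i: "i < n" and ker: "ad (f_mat n) A = 0\<^sub>m n n"
  shows "A = A $$ (n - 1, n - 1 - i) \<cdot>\<^sub>m binom_mat n i"
proof (rule of_weight_eqI[OF A of_weight_smult[OF of_weight_binom_mat]])
  define x where "x = A $$ (n - 1, n - 1 - i)"
  have *: "A $$ (n - 1 - d, n - 1 - i - d) = x * of_nat ((i + d) choose i)" if "d \<le> n - 1 - i" for d
    using that
  proof (induction d)
    case (Suc d)
    have "ad (f_mat n) A $$ (n - 1 - d, n - 1 - i - Suc d) = 0"
      using ker Suc.prems i by simp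
    moreover have "n - (n - 1 - d) = d + 1" "n - 1 - (n - 1 - i - Suc d) = i + d + 1"
      "n - 1 - d - 1 = n - 1 - Suc d" "n - 1 - i - Suc d + 1 = n - 1 - i - d" "n - 1 - d \<ge> 1"
      "n - 1 - i - d < n" "n - 1 - d < n" "n - 1 - i - Suc d < n"
      using Suc.prems i by auto
    ultimately have "of_nat (d + 1) * A $$ (n - 1 - Suc d, n - 1 - i - Suc d)
        = A $$ (n - 1 - d, n - 1 - i - d) * of_nat (i + d + 1)"
      by (subst (asm) ad_f_index[OF of_weight_carrier[OF A]]) (simp_all del: of_nat_add of_nat_Suc)
    also have "\<dots> = x * (of_nat ((i + d) choose i) * of_nat (i + d + 1))"
      using Suc by simp
    \<comment> \<open>Both products equal (i + d + 1)! / (i! d!).\<close>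
    also have "of_nat ((i + d) choose i) * of_nat (i + d + 1)
        = (of_nat (d + 1) * of_nat ((i + Suc d) choose i) :: complex)"
    proof -
      have "((i + d) choose i) * (i + d + 1) = (d + 1) * ((i + Suc d) choose i)"
        using Suc_times_binomial_eq[of "i + d" d] binomial_symmetric[of i "i + d"]
          binomial_symmetric[of i "i + Suc d"] by (simp add: mult.commute del: binomial_Suc_Suc)
      then show ?thesis by (simp only: flip: of_nat_mult)
    qed
    finally have "of_nat (d + 1) * A $$ (n - 1 - Suc d, n - 1 - i - Suc d)
        = of_nat (d + 1) * (x * of_nat ((i + Suc d) choose i))" by (simp only: mult.left_commute)
    then show ?case by (simp only: mult_cancel_left of_nat_eq_0_iff) simp
  qed (simp add: x_def)
  fix a b assume ab: "a < n" "b < n" "int b - int a = - int i"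
  then have a: "a = b + i" by simp
  have "A $$ (a, b) = x * of_nat ((n - 1 - b) choose i)"
    using *[of "n - 1 - a"] ab a by (simp add: add.commute)
  then show "A $$ (a, b) = (A $$ (n - 1, n - 1 - i) \<cdot>\<^sub>m binom_mat n i) $$ (a, b)"
    using ab a by (simp add: x_def binom_mat_def)
qed

lemma binom_mat_corner: "i < n \<Longrightarrow> binom_mat n i $$ (n - 1, n - 1 - i) = 1"
  by (auto simp: binom_mat_def)

text \<open>For uniqueness, a candidate is x times \<open>binom_mat n i\<close>. Its corner entry x
  is a positive integer, and an entry 1 makes x a divisor of 1.\<close>

lemma f_elt_eq:
  assumes "1 \<le> i" "i < n"
  shows "f_elt n i = binom_mat n i"
  unfolding f_elt_def
proof (rule the_equality, intro conjI ballI)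
  show "binom_mat n i \<in> S_space n (- int i)"
    using assms of_weight_binom_mat[of n i] by (auto simp: S_space_iff binom_mat_def)
  show "ad (f_mat n) (binom_mat n i) = 0\<^sub>m n n" by (rule ad_f_binom_mat)
  show "1 \<in> nonzero_entries (binom_mat n i)"
    using binom_mat_corner[OF assms(2)] assms unfolding nonzero_entries_def
    by (intro CollectI exI[of _ "n - 1"] exI[of _ "n - 1 - i"]) (auto simp: binom_mat_def)
  fix x assume "x \<in> nonzero_entries (binom_mat n i)"
  then obtain b where "x = of_nat ((n - 1 - b) choose i)" "x \<noteq> 0"
    by (auto simp: nonzero_entries_def binom_mat_def split: if_splits)
  then show "\<exists>m::nat. m \<ge> 1 \<and> x = of_nat m"
    by (intro exI[of _ "(n - 1 - b) choose i"]) (auto simp: Suc_le_eq simp del: zero_less_binomial_iff intro: Nat.gr0I)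
next
  fix A assume A: "A \<in> S_space n (- int i) \<and> ad (f_mat n) A = 0\<^sub>m n n \<and>
      (\<forall>x\<in>nonzero_entries A. \<exists>m::nat. m \<ge> 1 \<and> x = of_nat m) \<and> 1 \<in> nonzero_entries A"
  define x where "x = A $$ (n - 1, n - 1 - i)"
  have Ax: "A = x \<cdot>\<^sub>m binom_mat n i"
    using A ker_ad_f_lower[of n i A] assms by (auto simp: x_def S_space_iff)
  have dim: "dim_row A = n" "dim_col A = n" using A by (auto simp: S_space_iff of_weight_def)
  from A obtain a b where ab: "a < n" "b < n" "A $$ (a, b) = 1"
    by (auto simp: nonzero_entries_def dim)
  then have 1: "x * of_nat ((n - 1 - b) choose i) = 1"
    by (subst (asm) Ax) (auto simp: binom_mat_def split: if_splits)
  then have "x \<noteq> 0" by auto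
  then have "x \<in> nonzero_entries A"
    unfolding nonzero_entries_def x_def using assms
    by (intro CollectI exI[of _ "n - 1"] exI[of _ "n - 1 - i"]) (auto simp: dim)
  then obtain m :: nat where m: "x = of_nat m" using A by blast
  have "m * ((n - 1 - b) choose i) = 1"
    using 1 unfolding m by (metis of_nat_eq_1_iff of_nat_mult)
  then have "x = 1" using m by simp
  then show "A = binom_mat n i" unfolding Ax by (intro eq_matI) auto
qed

text \<open>Above the main diagonal the recursion starts in the first row, where [f, A] has a single
  term and forces a zero; the zeros then propagate down the diagonal.\<close>

lemma ker_ad_f_upper:
  assumes A: "of_weight n m A" and m: "m \<ge> 1" and ker: "ad (f_mat n) A = 0\<^sub>m n n"
  shows "A = 0\<^sub>m n n"
proof (rule of_weight_eqI[OF A of_weight_zero])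
  define k where "k = nat (m - 1)"
  have k: "m = int (Suc k)" using m by (simp add: k_def)
  have *: "A $$ (a, a + Suc k) = 0" if "a + Suc k < n" for a
    using that
  proof (induction a)
    case 0
    have "ad (f_mat n) A $$ (0, k) = 0" using ker 0 by simp
    with 0 have "A $$ (0, Suc k) * of_nat (n - 1 - k) = 0"
      by (subst (asm) ad_f_index[OF of_weight_carrier[OF A]]) auto
    with 0 show ?case by (simp del: of_nat_diff)
  next
    case (Suc a)
    have "ad (f_mat n) A $$ (Suc a, a + Suc k) = 0" using ker Suc by simp
    with Suc have "A $$ (Suc a, Suc a + Suc k) * of_nat (n - 1 - (a + Suc k)) = 0"
      by (subst (asm) ad_f_index[OF of_weight_carrier[OF A]]) auto
    with Suc.prems show ?case by (simp del: of_nat_diff)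
  qed
  fix a b assume ab: "a < n" "b < n" "int b - int a = m"
  then have "b = a + Suc k" using k by simp
  then show "A $$ (a, b) = 0\<^sub>m n n $$ (a, b)" using * ab by simp
qed

section \<open>Strings generated by the commutator with e\<close>

text \<open>The vectors \<open>v_elt n i j\<close> indexed by the number r = i + j of applications
  of \<open>ad (e_mat n)\<close>, which makes induction on r available.\<close>

definition e_string :: "nat \<Rightarrow> nat \<Rightarrow> nat \<Rightarrow> complex mat" where
  "e_string n i r = (ad (e_mat n) ^^ r) (binom_mat n i)"

lemma e_string_0 [simp]: "e_string n i 0 = binom_mat n i"
  and e_string_Suc: "e_string n i (Suc r) = ad (e_mat n) (e_string n i r)"
  by (auto simp: e_string_def)

lemma of_weight_e_string: "of_weight n (int r - int i) (e_string n i r)"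
proof (induction r)
  case (Suc r)
  from of_weight_ad[OF of_weight_e this] show ?case by (simp add: e_string_Suc algebra_simps)
qed (simp add: of_weight_binom_mat)

text \<open>Moving f past each e costs [f, e] = -h, which contributes 2(i - s) at level s; the sum
  over s from 0 to r is (r + 1)(2i - r).\<close>

lemma ad_f_e_string:
  "ad (f_mat n) (e_string n i (Suc r)) = of_int ((int r + 1) * (2 * int i - int r)) \<cdot>\<^sub>m e_string n i r"
proof -
  \<comment> \<open>-h acts on the vector of weight r - i as 2(i - r). Skew symmetry moves the sign
    into the second argument, where \<open>ad_smult\<close> extracts it.\<close>
  have fe: "ad (ad (f_mat n) (e_mat n)) (e_string n i r) = of_int (2 * (int i - int r)) \<cdot>\<^sub>m e_string n i r" for r
  proof -
    have c: "e_string n i r \<in> carrier_mat n n" using of_weight_e_string of_weight_carrier by blast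
    have "ad (ad (f_mat n) (e_mat n)) (e_string n i r) = (-1) \<cdot>\<^sub>m ad (e_string n i r) ((-1) \<cdot>\<^sub>m h_mat n)"
      using ad_skew[of "f_mat n" n "e_mat n"] ad_skew[of "ad (f_mat n) (e_mat n)" n "e_string n i r"] c
      by (simp add: ad_e_f)
    also have "\<dots> = (-1) \<cdot>\<^sub>m ((-1) \<cdot>\<^sub>m ((-1) \<cdot>\<^sub>m ad (h_mat n) (e_string n i r)))"
      using c by (subst ad_smult[of _ n]) (auto simp: ad_skew[of "e_string n i r" n "h_mat n"])
    also have "\<dots> = (-1) \<cdot>\<^sub>m (of_int (2 * (int r - int i)) \<cdot>\<^sub>m e_string n i r)"
      unfolding ad_h_of_weight[OF of_weight_e_string] by (rule eq_matI) auto
    also have "\<dots> = of_int (2 * (int i - int r)) \<cdot>\<^sub>m e_string n i r"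
      by (rule eq_matI) (auto simp: algebra_simps)
    finally show ?thesis .
  qed
  have J: "ad (f_mat n) (e_string n i (Suc r))
      = of_int (2 * (int i - int r)) \<cdot>\<^sub>m e_string n i r + ad (e_mat n) (ad (f_mat n) (e_string n i r))" for r
    unfolding e_string_Suc fe[symmetric]
    by (rule ad_jacobi[OF f_mat_carrier e_mat_carrier of_weight_carrier[OF of_weight_e_string]])
  show ?thesis
  proof (induction r)
    case 0
    show ?case unfolding J by (simp add: ad_f_binom_mat)
  next
    case (Suc r)
    have c: "e_string n i s \<in> carrier_mat n n" for s using of_weight_e_string of_weight_carrier by blast
    show ?case unfolding J[of "Suc r"] Suc
      by (subst ad_smult[OF e_mat_carrier c], unfold e_string_Suc[symmetric], rule eq_matI)
        (auto simp: algebra_simps)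
  qed
qed

text \<open>At r = 2i the factor 2i - r is zero, so f kills the next vector; this has weight i + 1 >
  0, where f has no kernel.\<close>

lemma e_string_top: "e_string n i (Suc (2 * i)) = 0\<^sub>m n n"
proof (rule ker_ad_f_upper)
  show "of_weight n (int i + 1) (e_string n i (Suc (2 * i)))"
    using of_weight_e_string[of n "Suc (2 * i)" i] by (simp add: algebra_simps)
  have "e_string n i (2 * i) \<in> carrier_mat n n" using of_weight_e_string of_weight_carrier by blast
  then show "ad (f_mat n) (e_string n i (Suc (2 * i))) = 0\<^sub>m n n"
    unfolding ad_f_e_string by (intro eq_matI) auto
qed simp

lemma v_elt_eq: "1 \<le> i \<Longrightarrow> i < n \<Longrightarrow> v_elt n i j = e_string n i (nat (int i + j))"
  by (simp add: v_elt_def f_elt_eq e_string_def)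

lemma v_elt_carrier [simp]: "1 \<le> i \<Longrightarrow> i < n \<Longrightarrow> v_elt n i j \<in> carrier_mat n n"
  using of_weight_e_string of_weight_carrier by (simp add: v_elt_eq) blast

lemma of_weight_v_elt: "1 \<le> i \<Longrightarrow> i < n \<Longrightarrow> - int i \<le> j \<Longrightarrow> of_weight n j (v_elt n i j)"
  using of_weight_e_string[of n "nat (int i + j)" i] by (simp add: v_elt_eq)

lemma v_elt_lowest: "1 \<le> i \<Longrightarrow> i < n \<Longrightarrow> v_elt n i (- int i) = binom_mat n i"
  by (simp add: v_elt_eq)

lemma ad_e_v_elt:
  assumes "1 \<le> i" "i < n" "- int i \<le> j"
  shows "ad (e_mat n) (v_elt n i j) = v_elt n i (j + 1)"
proof -
  have "nat (int i + (j + 1)) = Suc (nat (int i + j))" using assms by linarith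
  with assms show ?thesis by (simp only: v_elt_eq e_string_Suc)
qed

lemma v_elt_top: "1 \<le> i \<Longrightarrow> i < n \<Longrightarrow> v_elt n i (int i + 1) = 0\<^sub>m n n"
proof -
  have "nat (int i + (int i + 1)) = Suc (2 * i)" by simp
  then show "1 \<le> i \<Longrightarrow> i < n \<Longrightarrow> ?thesis" by (simp only: v_elt_eq e_string_top)
qed

text \<open>The formula of \<open>ad_f_e_string\<close> with r = i + j - 1. At j = -i the vector is
  killed by f, in agreement with the factor i + j = 0.\<close>

lemma ad_f_v_elt:
  assumes "1 \<le> i" "i < n" "- int i \<le> j"
  shows "ad (f_mat n) (v_elt n i j) = of_int ((int i + j) * (int i - j + 1)) \<cdot>\<^sub>m v_elt n i (j - 1)"
proof (cases "j = - int i")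
  case True
  have "dim_row (v_elt n i (j - 1)) = n" "dim_col (v_elt n i (j - 1)) = n"
    using carrier_matD[OF v_elt_carrier[OF assms(1,2)]] by auto
  with True assms show ?thesis by (intro eq_matI) (auto simp: v_elt_lowest ad_f_binom_mat)
next
  case False
  define r where "r = nat (int i + j - 1)"
  have r: "nat (int i + j) = Suc r" "nat (int i + (j - 1)) = r" "int r = int i + j - 1"
    using assms False by (auto simp: r_def)
  show ?thesis using assms unfolding v_elt_eq[OF assms(1,2)] r ad_f_e_string by (simp add: algebra_simps)
qed

subsection \<open>Independence and rational spanning\<close>

text \<open>
  For \<open>j < - l\<close> the truncated exponent in \<open>v_elt\<close> makes \<open>v_elt n l j\<close> equal to \<open>f_elt n l\<close>, which has the
  wrong weight; sums over \<open>l\<close> are therefore restricted to the following indices.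
\<close>

definition string_indices :: "nat \<Rightarrow> int \<Rightarrow> nat set" where
  "string_indices n j = {l\<in>{1..n - 1}. \<bar>j\<bar> \<le> int l}"

lemma finite_string_indices [simp]: "finite (string_indices n j)"
  by (simp add: string_indices_def)

lemma string_indicesD:
  assumes "l \<in> string_indices n j"
  shows "1 \<le> l" "l < n" "- int l \<le> j" "j \<le> int l"
  using assms by (auto simp: string_indices_def)

lemma string_indices_uminus: "string_indices n (- int J) = {max 1 J..n - 1}"
  by (auto simp: string_indices_def)

lemma mat_sum_mono_neutral:
  assumes "finite J" "I \<subseteq> J" "\<And>i. i \<in> J - I \<Longrightarrow> M i = 0\<^sub>m n n"
  shows "mat_sum n M J = mat_sum n M I"
  using assms by (intro eq_matI) (auto simp: mat_sum_def intro!: sum.mono_neutral_right)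

lemma mat_sum_v_elt_carrier_smult:
  assumes "l \<in> string_indices n j"
  shows "x \<cdot>\<^sub>m v_elt n l k \<in> carrier_mat n n"
  using string_indicesD[OF assms] by simp

lemma smult_smult_mat: "x \<cdot>\<^sub>m (y \<cdot>\<^sub>m A) = (x * y) \<cdot>\<^sub>m (A :: complex mat)"
  by (intro eq_matI) auto

lemma smult_zero_mat: "A \<in> carrier_mat n n \<Longrightarrow> 0 \<cdot>\<^sub>m A = (0\<^sub>m n n :: complex mat)"
  by (intro eq_matI) auto

text \<open>Induction on the weight from below. The commutator with f carries a relation in weight j
  to weight j - 1 and multiplies coefficients by (l + j)(l - j + 1), which is non-zero unless l =
  -j.\<close>

lemma v_elt_independent:
  assumes "mat_sum n (\<lambda>l. x l \<cdot>\<^sub>m v_elt n l j) (string_indices n j) = 0\<^sub>m n n"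
    and "l \<in> string_indices n j"
  shows "x l = 0"
  using assms
proof (induction "nat (j + int n)" arbitrary: j x l)
  case 0
  \<comment> \<open>For j at most -n there is no string, since l < n.\<close>
  then show ?case using string_indicesD[OF 0(3)] by auto
next
  case (Suc t)
  let ?I = "string_indices n"
  \<comment> \<open>The coefficients of the image in weight j - 1. A string in only one of the two
    index sets is l = -j, where the factor is zero, or l = j - 1, where \<open>y\<close> is set to
    zero.\<close>
  define y where "y l = (if l \<in> ?I j then x l * of_int ((int l + j) * (int l - j + 1)) else 0)" for l
  have "mat_sum n (\<lambda>l. y l \<cdot>\<^sub>m v_elt n l (j - 1)) (?I (j - 1))
      = mat_sum n (\<lambda>l. y l \<cdot>\<^sub>m v_elt n l (j - 1)) (?I (j - 1) \<union> ?I j)"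
  proof (rule mat_sum_mono_neutral[symmetric], goal_cases)
    case (3 l)
    then have "j = - int l" by (auto simp: string_indices_def)
    with 3 have "y l = 0" "l \<in> ?I j" by (auto simp: y_def)
    then show ?case using string_indicesD[of l n j] by (simp add: smult_zero_mat)
  qed auto
  also have "\<dots> = mat_sum n (\<lambda>l. y l \<cdot>\<^sub>m v_elt n l (j - 1)) (?I j)"
    using string_indicesD[of _ n "j - 1"]
    by (intro mat_sum_mono_neutral) (auto simp: y_def intro!: smult_zero_mat v_elt_carrier)
  also have "\<dots> = mat_sum n (\<lambda>l. ad (f_mat n) (x l \<cdot>\<^sub>m v_elt n l j)) (?I j)"
    using string_indicesD[of _ n j]
    by (intro mat_sum_cong)
      (auto simp: y_def ad_smult[OF f_mat_carrier v_elt_carrier] ad_f_v_elt smult_smult_mat)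
  also have "\<dots> = ad (f_mat n) (mat_sum n (\<lambda>l. x l \<cdot>\<^sub>m v_elt n l j) (?I j))"
    by (intro ad_mat_sum[symmetric] f_mat_carrier mat_sum_v_elt_carrier_smult)
  also have "\<dots> = 0\<^sub>m n n" using Suc.prems by simp
  finally have "mat_sum n (\<lambda>l. y l \<cdot>\<^sub>m v_elt n l (j - 1)) (?I (j - 1)) = 0\<^sub>m n n" .
  moreover have "t = nat (j - 1 + int n)" using Suc.hyps(2) by linarith
  ultimately have y0: "y l = 0" if "l \<in> ?I (j - 1)" for l using Suc.hyps(1) that by blast
  have x0: "x l = 0" if "l \<in> ?I j" "j \<noteq> - int l" for l
  proof -
    have "l \<in> ?I (j - 1)" using that by (auto simp: string_indices_def)
    from y0[OF this] that have "x l * of_int ((int l + j) * (int l - j + 1)) = 0" by (simp add: y_def)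
    moreover have "(int l + j) * (int l - j + 1) \<noteq> 0" using that string_indicesD[OF that(1)] by auto
    ultimately show ?thesis by (metis mult_eq_0_iff of_int_eq_0_iff)
  qed
  show ?case
  proof (cases "j = - int l")
    case True
    note l = string_indicesD[OF Suc.prems(2)]
    \<comment> \<open>Only the string starting in weight j is left; its coefficient is read off at
      the corner entry 1 of \<open>binom_mat n l\<close>.\<close>
    have "mat_sum n (\<lambda>l. x l \<cdot>\<^sub>m v_elt n l j) (?I j) = mat_sum n (\<lambda>l. x l \<cdot>\<^sub>m v_elt n l j) {l}"
    proof (rule mat_sum_mono_neutral)
      fix i assume i: "i \<in> ?I j - {l}"
      then have "x i = 0" using x0[of i] True by auto
      then show "x i \<cdot>\<^sub>m v_elt n i j = 0\<^sub>m n n"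
        using string_indicesD[of i n j] i by (simp add: smult_zero_mat)
    qed (use Suc.prems in auto)
    then have "mat_sum n (\<lambda>l. x l \<cdot>\<^sub>m v_elt n l j) {l} = 0\<^sub>m n n"
      using Suc.prems(1) by simp
    then have "x l \<cdot>\<^sub>m binom_mat n l = 0\<^sub>m n n"
      using l True by (simp add: mat_sum_singleton v_elt_lowest)
    then have "(x l \<cdot>\<^sub>m binom_mat n l) $$ (n - 1, n - 1 - l) = 0" using l by simp
    then show ?thesis
      using l binom_mat_corner[of l n] by (simp add: carrier_matD[OF binom_mat_carrier])
  qed (use x0 Suc.prems in auto)
qed

lemma v_elt_unique:
  assumes eq: "mat_sum n (\<lambda>l. x l \<cdot>\<^sub>m v_elt n l j) (string_indices n j)
      = mat_sum n (\<lambda>l. y l \<cdot>\<^sub>m v_elt n l j) (string_indices n j)"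
    and l: "l \<in> string_indices n j"
  shows "x l = y l"
proof -
  have "mat_sum n (\<lambda>l. (x l - y l) \<cdot>\<^sub>m v_elt n l j) (string_indices n j) = 0\<^sub>m n n"
  proof (rule eq_matI)
    fix a b assume "a < dim_row (0\<^sub>m n n :: complex mat)" "b < dim_col (0\<^sub>m n n :: complex mat)"
    then have ab: "a < n" "b < n" by auto
    have dim: "dim_row (v_elt n l j) = n" "dim_col (v_elt n l j) = n" if "l \<in> string_indices n j" for l
      using carrier_matD[OF v_elt_carrier[OF string_indicesD(1,2)[OF that]]] by auto
    have "mat_sum n (\<lambda>l. x l \<cdot>\<^sub>m v_elt n l j) (string_indices n j) $$ (a, b)
        = mat_sum n (\<lambda>l. y l \<cdot>\<^sub>m v_elt n l j) (string_indices n j) $$ (a, b)"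
      using eq by simp
    then show "mat_sum n (\<lambda>l. (x l - y l) \<cdot>\<^sub>m v_elt n l j) (string_indices n j) $$ (a, b) = 0\<^sub>m n n $$ (a, b)"
      using ab by (simp add: dim algebra_simps sum_subtractf)
  qed (auto simp: mat_sum_def)
  from v_elt_independent[OF this l] show ?thesis by simp
qed

section \<open>Expansions with rational coefficients\<close>

text \<open>\<open>struct_const\<close> takes values in the rationals, so expansions must be found
  over them; rational entries are what guarantees this.\<close>

definition rat_mat :: "nat \<Rightarrow> complex mat \<Rightarrow> bool" where
  "rat_mat n A \<longleftrightarrow> A \<in> carrier_mat n n \<and> (\<forall>a<n. \<forall>b<n. A $$ (a, b) \<in> \<rat>)"

lemma rat_mat_ad: "rat_mat n A \<Longrightarrow> rat_mat n B \<Longrightarrow> rat_mat n (ad A B)"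
  by (auto simp: rat_mat_def ad_index intro!: Rats_diff Rats_sum Rats_mult)

lemma rat_mat_e: "rat_mat n (e_mat n)"
  and rat_mat_f: "rat_mat n (f_mat n)"
  and rat_mat_binom_mat: "rat_mat n (binom_mat n i)"
  by (auto simp: rat_mat_def e_mat_def f_mat_def binom_mat_def Rats_of_nat simp del: of_nat_diff)

lemma rat_mat_v_elt:
  assumes "1 \<le> i" "i < n"
  shows "rat_mat n (v_elt n i j)"
proof -
  have "rat_mat n (e_string n i r)" for r
    by (induction r) (simp_all add: rat_mat_binom_mat e_string_Suc rat_mat_ad rat_mat_e)
  with assms show ?thesis by (simp add: v_elt_eq)
qed

lemma trace_v_elt_0:
  assumes "1 \<le> i" "i < n"
  shows "(\<Sum>a<n. v_elt n i 0 $$ (a, a)) = 0"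
proof -
  have "v_elt n i 0 = ad (e_mat n) (v_elt n i (- 1))" using assms by (simp add: ad_e_v_elt)
  with assms show ?thesis by (simp add: trace_ad)
qed

text \<open>Induction from weight -n upwards. Expanding [f, A] one weight lower and dividing by the
  ladder factors gives D with [f, D] = [f, A]; then A - D lies in the kernel of
  \<open>ad (f_mat n)\<close>, hence is a multiple of \<open>binom_mat n J\<close>.\<close>

lemma v_elt_span:
  assumes "J \<le> n" "of_weight n (- int J) A" "rat_mat n A" "J = 0 \<Longrightarrow> (\<Sum>a<n. A $$ (a, a)) = 0"
  shows "\<exists>c. (\<forall>l. l \<notin> {max 1 J..n - 1} \<longrightarrow> c l = 0) \<and>
           A = mat_sum n (\<lambda>l. of_rat (c l) \<cdot>\<^sub>m v_elt n l (- int J)) {max 1 J..n - 1}"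
  using assms
proof (induction "n - J" arbitrary: J A)
  case 0
  \<comment> \<open>Here J = n, and no entry of an n by n matrix has weight -n.\<close>
  then have "A = mat_sum n (\<lambda>l. of_rat 0 \<cdot>\<^sub>m v_elt n l (- int J)) {max 1 J..n - 1}"
    by (intro of_weight_eqI[of n "- int J"] of_weight_mat_sum) auto
  then show ?case by (intro exI[of _ "\<lambda>_. 0"]) auto
next
  case (Suc t)
  let ?B = "ad (f_mat n) A"
  have carA [simp]: "A \<in> carrier_mat n n" using Suc.prems of_weight_carrier by blast
  have J: "J < n" using Suc.hyps by linarith
  have Suc_J: "- int (Suc J) = - int J - 1" by simp
  have wB: "of_weight n (- int (Suc J)) ?B"
    using of_weight_ad[OF of_weight_f Suc.prems(2)] by (simp add: algebra_simps)
  have "\<exists>c. (\<forall>l. l \<notin> {max 1 (Suc J)..n - 1} \<longrightarrow> c l = 0) \<and>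
           ?B = mat_sum n (\<lambda>l. of_rat (c l) \<cdot>\<^sub>m v_elt n l (- int (Suc J))) {max 1 (Suc J)..n - 1}"
  proof (rule Suc.hyps(1))
    show "t = n - Suc J" using Suc.hyps(2) by linarith
    show "rat_mat n ?B" using Suc.prems(3) by (simp add: rat_mat_ad rat_mat_f)
  qed (use J wB in auto)
  then obtain c' where c': "?B = mat_sum n (\<lambda>l. of_rat (c' l) \<cdot>\<^sub>m v_elt n l (- int (Suc J))) {Suc J..n - 1}"
    by auto
  \<comment> \<open>The divisor is the factor of \<open>ad_f_v_elt\<close> at weight -J, positive
    for l > J.\<close>
  define c where "c l = c' l / of_int ((int l - int J) * (int l + int J + 1))" for l
  define D where "D = mat_sum n (\<lambda>l. of_rat (c l) \<cdot>\<^sub>m v_elt n l (- int J)) {Suc J..n - 1}"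
  have wD: "of_weight n (- int J) D"
    unfolding D_def by (intro of_weight_mat_sum of_weight_smult of_weight_v_elt) auto
  then have carD [simp]: "D \<in> carrier_mat n n" by (rule of_weight_carrier)
  have rD: "rat_mat n D"
  proof -
    have "(\<Sum>l\<in>{Suc J..n - 1}. (of_rat (c l) \<cdot>\<^sub>m v_elt n l (- int J)) $$ (a, b)) \<in> \<rat>" if "a < n" "b < n" for a b
    proof (rule Rats_sum)
      fix l assume "l \<in> {Suc J..n - 1}"
      then have "rat_mat n (v_elt n l (- int J))" by (intro rat_mat_v_elt) auto
      then show "(of_rat (c l) \<cdot>\<^sub>m v_elt n l (- int J)) $$ (a, b) \<in> \<rat>"
        using that by (auto simp: rat_mat_def)
    qed
    then show ?thesis by (simp add: rat_mat_def D_def)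
  qed
  have fD: "ad (f_mat n) D = ?B"
    unfolding D_def c'
  proof (subst ad_mat_sum[OF f_mat_carrier], goal_cases)
    case 2
    show ?case
    proof (rule mat_sum_cong)
      fix l assume l: "l \<in> {Suc J..n - 1}"
      then have "ad (f_mat n) (of_rat (c l) \<cdot>\<^sub>m v_elt n l (- int J))
          = (of_rat (c l) * of_int ((int l - int J) * (int l + int J + 1))) \<cdot>\<^sub>m v_elt n l (- int J - 1)"
        by (subst ad_smult[OF f_mat_carrier v_elt_carrier])
          (auto simp: ad_f_v_elt smult_smult_mat algebra_simps diff_diff_eq)
      also have "of_rat (c l) * of_int ((int l - int J) * (int l + int J + 1)) = (of_rat (c' l) :: complex)"
      proof -
        have "(of_int ((int l - int J) * (int l + int J + 1)) :: rat) \<noteq> 0"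
          using l unfolding of_int_eq_0_iff by auto
        then have "c l * of_int ((int l - int J) * (int l + int J + 1)) = c' l"
          by (simp add: c_def del: of_int_mult of_int_add of_int_diff)
        then show ?thesis by (metis of_rat_mult of_rat_of_int_eq)
      qed
      finally show "ad (f_mat n) (of_rat (c l) \<cdot>\<^sub>m v_elt n l (- int J))
          = of_rat (c' l) \<cdot>\<^sub>m v_elt n l (- int (Suc J))" unfolding Suc_J .
    qed simp
  qed auto
  define E where "E = A + (-1) \<cdot>\<^sub>m D"
  have wE: "of_weight n (- int J) E"
    unfolding E_def by (intro of_weight_add of_weight_smult Suc.prems wD)
  have fE: "ad (f_mat n) E = 0\<^sub>m n n"
  proof -
    have "ad (f_mat n) E = ?B + (-1) \<cdot>\<^sub>m ?B"
      unfolding E_def by (subst ad_add[of _ n]) (auto simp: ad_smult[of _ n] fD)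
    also have "\<dots> = 0\<^sub>m n n"
      using carrier_matD[OF ad_carrier[OF f_mat_carrier carA]] by (intro eq_matI) auto
    finally show ?thesis .
  qed
  define x where "x = E $$ (n - 1, n - 1 - J)"
  have E: "E = x \<cdot>\<^sub>m binom_mat n J" unfolding x_def by (rule ker_ad_f_lower[OF wE J fE])
  have AE: "A $$ (a, b) = D $$ (a, b) + x * binom_mat n J $$ (a, b)" if "a < n" "b < n" for a b
  proof -
    have "E $$ (a, b) = A $$ (a, b) - D $$ (a, b)" using that carA carD by (simp add: E_def del: carA carD)
    with that E show ?thesis by (simp add: binom_mat_def)
  qed
  show ?case
  proof (cases "J = 0")
    case True
    have "(\<Sum>a<n. D $$ (a, a)) = 0"
    proof -
      have "(\<Sum>a<n. D $$ (a, a)) = (\<Sum>l\<in>{Suc J..n - 1}. of_rat (c l) * (\<Sum>a<n. v_elt n l 0 $$ (a, a)))"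
      proof -
        have "D $$ (a, a) = (\<Sum>l\<in>{Suc J..n - 1}. of_rat (c l) * v_elt n l 0 $$ (a, a))" if "a < n" for a
          unfolding D_def using True that carrier_matD[OF v_elt_carrier[of _ n 0]]
          by (auto intro!: sum.cong)
        then have "(\<Sum>a<n. D $$ (a, a)) = (\<Sum>a<n. \<Sum>l\<in>{Suc J..n - 1}. of_rat (c l) * v_elt n l 0 $$ (a, a))"
          by simp
        then show ?thesis unfolding sum_distrib_left by (subst (asm) sum.swap)
      qed
      moreover have "(\<Sum>a<n. v_elt n l 0 $$ (a, a)) = 0" if "l \<in> {Suc J..n - 1}" for l
        using that J by (intro trace_v_elt_0) auto
      ultimately show ?thesis by simp
    qed
    moreover have "(\<Sum>a<n. A $$ (a, a)) = 0" using Suc.prems True by blast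
    \<comment> \<open>\<open>binom_mat n 0\<close> is the identity, so the traces of A and D differ
      by nx; both vanish, which removes the kernel part.\<close>
    moreover have "(\<Sum>a<n. A $$ (a, a)) = (\<Sum>a<n. D $$ (a, a)) + x * of_nat n"
      using True by (simp add: AE sum.distrib binom_mat_def)
    ultimately have "x = 0" using J by simp
    then have "A = D"
      using AE by (intro of_weight_eqI[OF Suc.prems(2) wD]) simp
    then show ?thesis using True
      by (intro exI[of _ "\<lambda>l. if l \<in> {1..n - 1} then c l else 0"]) (auto simp: D_def intro!: mat_sum_cong)
  next
    case False
    have "x \<in> \<rat>"
    proof -
      \<comment> \<open>The corner entry of \<open>binom_mat n J\<close> is 1, so x is a difference
        of rational entries.\<close>
      have "A $$ (n - 1, n - 1 - J) - D $$ (n - 1, n - 1 - J) \<in> \<rat>"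
        using rD Suc.prems(3) J by (intro Rats_diff) (auto simp: rat_mat_def)
      moreover have "x = A $$ (n - 1, n - 1 - J) - D $$ (n - 1, n - 1 - J)"
        using AE[of "n - 1" "n - 1 - J"] J binom_mat_corner[OF J] by simp
      ultimately show ?thesis by simp
    qed
    then obtain q where q: "x = of_rat q" by (auto simp: Rats_def)
    define d where "d l = (if l = J then q else if l \<in> {Suc J..n - 1} then c l else 0)" for l
    have I: "{max 1 J..n - 1} = insert J {Suc J..n - 1}" using False J by auto
    have "A = mat_sum n (\<lambda>l. of_rat (d l) \<cdot>\<^sub>m v_elt n l (- int J)) {max 1 J..n - 1}"
    proof (rule of_weight_eqI[OF Suc.prems(2)])
      show "of_weight n (- int J) (mat_sum n (\<lambda>l. of_rat (d l) \<cdot>\<^sub>m v_elt n l (- int J)) {max 1 J..n - 1})"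
        by (intro of_weight_mat_sum of_weight_smult of_weight_v_elt) auto
      fix a b assume ab: "a < n" "b < n"
      have "mat_sum n (\<lambda>l. of_rat (d l) \<cdot>\<^sub>m v_elt n l (- int J)) {max 1 J..n - 1} $$ (a, b)
          = (of_rat q \<cdot>\<^sub>m binom_mat n J) $$ (a, b) + D $$ (a, b)"
        using ab False J unfolding I D_def by (simp add: d_def v_elt_lowest)
      then show "A $$ (a, b) = mat_sum n (\<lambda>l. of_rat (d l) \<cdot>\<^sub>m v_elt n l (- int J)) {max 1 J..n - 1} $$ (a, b)"
        using AE ab q by (simp add: binom_mat_def)
    qed
    then show ?thesis using False J by (intro exI[of _ d]) (auto simp: d_def)
  qed
qed

text \<open>The commutator has weight -(n - 1) + (n - 1 - J) = -J, rational entries and trace zero,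
  so \<open>v_elt_span\<close> expands it and \<open>v_elt_unique\<close> makes the expansion
  unique. This justifies the definite description.\<close>

lemma struct_const_spec:
  assumes "k \<le> J" "J \<le> n - 1" "k \<noteq> n - 1"
  shows "ad (f_elt n (n - 1)) (v_elt n (n - 1 - k) (int n - 1 - int J)) =
          mat_sum n (\<lambda>l. of_rat (struct_const n l J k) \<cdot>\<^sub>m v_elt n l (- int J)) {max 1 J..n - 1}"
    and "l \<notin> {max 1 J..n - 1} \<Longrightarrow> struct_const n l J k = 0"
proof -
  have k: "1 \<le> n - 1 - k" "n - 1 - k < n" "1 \<le> n - 1" "n - 1 < n" using assms by auto
  let ?B = "ad (f_elt n (n - 1)) (v_elt n (n - 1 - k) (int n - 1 - int J))"
  define P where "P = (\<lambda>c :: nat \<Rightarrow> rat. (\<forall>l. l \<notin> {max 1 J..n - 1} \<longrightarrow> c l = 0) \<and>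
        ?B = mat_sum n (\<lambda>l. of_rat (c l) \<cdot>\<^sub>m v_elt n l (- int J)) {max 1 J..n - 1})"
  have "of_weight n (- int (n - 1)) (f_elt n (n - 1))"
    using k by (simp add: f_elt_eq of_weight_binom_mat del: of_nat_diff)
  moreover have wv: "of_weight n (int n - 1 - int J) (v_elt n (n - 1 - k) (int n - 1 - int J))"
    using k assms by (intro of_weight_v_elt) auto
  ultimately have w: "of_weight n (- int (n - 1) + (int n - 1 - int J)) ?B"
    by (rule of_weight_ad)
  have "- int (n - 1) + (int n - 1 - int J) = - int J" using k by linarith
  with w have "of_weight n (- int J) ?B" by simp
  moreover have "rat_mat n ?B"
    using k by (simp only: f_elt_eq) (intro rat_mat_ad rat_mat_binom_mat rat_mat_v_elt)
  moreover have "(\<Sum>a<n. ?B $$ (a, a)) = 0"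
    using k by (intro trace_ad) (auto simp: f_elt_eq)
  ultimately have "\<exists>c. P c" unfolding P_def using assms by (intro v_elt_span) auto
  moreover have "c = c'" if "P c" "P c'" for c c'
  proof
    fix l
    show "c l = c' l"
    proof (cases "l \<in> {max 1 J..n - 1}")
      case True
      have "of_rat (c l) = (of_rat (c' l) :: complex)"
        using that True unfolding P_def string_indices_uminus[symmetric] by (intro v_elt_unique) auto
      then show ?thesis by simp
    qed (use that in \<open>auto simp: P_def\<close>)
  qed
  ultimately have "P (THE c. P c)" by (metis theI)
  moreover have "(THE c. P c) = (\<lambda>l. struct_const n l J k)"
    by (simp add: struct_const_def P_def fun_eq_iff)
  ultimately have "P (\<lambda>l. struct_const n l J k)" by simp
  then show "?B = mat_sum n (\<lambda>l. of_rat (struct_const n l J k) \<cdot>\<^sub>m v_elt n l (- int J)) {max 1 J..n - 1}"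
    and "l \<notin> {max 1 J..n - 1} \<Longrightarrow> struct_const n l J k = 0"
    unfolding P_def by auto
qed

subsection \<open>Structure constants\<close>

lemma ad_zero_left [simp]: "A \<in> carrier_mat n n \<Longrightarrow> ad (0\<^sub>m n n) A = 0\<^sub>m n n"
  by (rule eq_matI) (auto simp: ad_def)

lemma smult_mat_sum:
  assumes "\<And>i. i \<in> I \<Longrightarrow> M i \<in> carrier_mat n n"
  shows "x \<cdot>\<^sub>m mat_sum n (\<lambda>i. c i \<cdot>\<^sub>m M i) I = mat_sum n (\<lambda>i. (x * c i) \<cdot>\<^sub>m M i) I"
proof (rule eq_matI)
  fix a b assume "a < dim_row (mat_sum n (\<lambda>i. (x * c i) \<cdot>\<^sub>m M i) I)"
    "b < dim_col (mat_sum n (\<lambda>i. (x * c i) \<cdot>\<^sub>m M i) I)"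
  then have "a < n" "b < n" by (auto simp: mat_sum_def)
  moreover from this have "a < dim_row (M i)" "b < dim_col (M i)" if "i \<in> I" for i
    using assms[OF that] by auto
  ultimately show "(x \<cdot>\<^sub>m mat_sum n (\<lambda>i. c i \<cdot>\<^sub>m M i) I) $$ (a, b)
      = mat_sum n (\<lambda>i. (x * c i) \<cdot>\<^sub>m M i) I $$ (a, b)"
    by (simp add: mat_sum_def sum_distrib_left mult.assoc)
qed (auto simp: mat_sum_def)

text \<open>Coefficients of \<open>v_elt n i (- int (Suc J))\<close> after applying f to the
  defining relation. The left factor is the ladder factor of the vector with index n - 1 - k and
  weight n - 1 - J, the right one that of index i and weight -J.\<close>

lemma struct_const_rec:
  assumes "k \<le> J" "J < i" "i \<le> n - 1" "k \<noteq> n - 1"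
  shows "of_int ((2 * int n - 2 - int k - int J) * (int J - int k + 1)) * struct_const n i (Suc J) k
       = of_int ((int i - int J) * (int i + int J + 1)) * struct_const n i J k"
proof -
  let ?F = "binom_mat n (n - 1)" and ?v = "v_elt n (n - 1 - k)"
  let ?j = "int n - 1 - int J"
  let ?c = "\<lambda>J l. of_rat (struct_const n l J k) :: complex"
  let ?x = "of_int ((2 * int n - 2 - int k - int J) * (int J - int k + 1)) :: complex"
  have k: "1 \<le> n - 1 - k" "n - 1 - k < n" "1 \<le> n - 1" "n - 1 < n" using assms by auto
  have Suc_J: "- int (Suc J) = - int J - 1" by simp
  have I: "{max 1 (Suc J)..n - 1} = string_indices n (- int (Suc J))" by (rule string_indices_uminus[symmetric])
  have "?x \<cdot>\<^sub>m ad ?F (?v (?j - 1)) = ad ?F (ad (f_mat n) (?v ?j))"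
  proof -
    have "ad (f_mat n) (?v ?j) = ?x \<cdot>\<^sub>m ?v (?j - 1)"
      using k assms by (subst ad_f_v_elt) (auto simp: of_nat_diff algebra_simps)
    then show ?thesis using k by (simp add: ad_smult[of _ n])
  qed
  \<comment> \<open>By the Jacobi identity, since f commutes with the lowest vector.\<close>
  also have "\<dots> = ad (f_mat n) (ad ?F (?v ?j))"
    using k by (subst ad_jacobi[of "f_mat n" n]) (auto simp: ad_f_binom_mat)
  also have "ad ?F (?v ?j) = mat_sum n (\<lambda>l. ?c J l \<cdot>\<^sub>m v_elt n l (- int J)) {max 1 J..n - 1}"
    using struct_const_spec(1)[of k J n] assms k by (simp only: f_elt_eq) simp
  also have "ad (f_mat n) \<dots>
      = mat_sum n (\<lambda>l. ad (f_mat n) (?c J l \<cdot>\<^sub>m v_elt n l (- int J))) {max 1 J..n - 1}"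
    by (rule ad_mat_sum) auto
  also have "\<dots> = mat_sum n (\<lambda>l. (of_int ((int l - int J) * (int l + int J + 1)) * ?c J l)
      \<cdot>\<^sub>m v_elt n l (- int (Suc J))) {max 1 J..n - 1}"
    by (intro mat_sum_cong refl, unfold Suc_J, subst ad_smult[OF f_mat_carrier v_elt_carrier])
      (auto simp: ad_f_v_elt smult_smult_mat algebra_simps)
  also have "\<dots> = mat_sum n (\<lambda>l. (of_int ((int l - int J) * (int l + int J + 1)) * ?c J l)
      \<cdot>\<^sub>m v_elt n l (- int (Suc J))) {max 1 (Suc J)..n - 1}"
  proof (rule mat_sum_mono_neutral)
    fix l assume l: "l \<in> {max 1 J..n - 1} - {max 1 (Suc J)..n - 1}"
    \<comment> \<open>This string starts in weight -J, so its factor l - J is zero.\<close>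
    then have "l = J" by auto
    then show "(of_int ((int l - int J) * (int l + int J + 1)) * ?c J l) \<cdot>\<^sub>m v_elt n l (- int (Suc J)) = 0\<^sub>m n n"
      using l by (auto intro!: smult_zero_mat v_elt_carrier)
  qed auto
  also have "ad ?F (?v (?j - 1)) = mat_sum n (\<lambda>l. ?c (Suc J) l \<cdot>\<^sub>m v_elt n l (- int (Suc J))) {max 1 (Suc J)..n - 1}"
    using struct_const_spec(1)[of k "Suc J" n] assms k by (simp only: f_elt_eq) (simp add: algebra_simps)
  also have "?x \<cdot>\<^sub>m \<dots> = mat_sum n (\<lambda>l. (?x * ?c (Suc J) l) \<cdot>\<^sub>m v_elt n l (- int (Suc J))) {max 1 (Suc J)..n - 1}"
    by (rule smult_mat_sum) auto
  finally have "?x * ?c (Suc J) i = of_int ((int i - int J) * (int i + int J + 1)) * ?c J i"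
    unfolding I by (rule v_elt_unique) (use assms in \<open>auto simp: string_indices_def\<close>)
  then have "(of_rat (of_int ((2 * int n - 2 - int k - int J) * (int J - int k + 1)) * struct_const n i (Suc J) k) :: complex)
       = of_rat (of_int ((int i - int J) * (int i + int J + 1)) * struct_const n i J k)"
    by (simp only: of_rat_mult of_rat_of_int_eq)
  then show ?thesis by (simp only: of_rat_eq_iff)
qed

text \<open>Both factors of \<open>struct_const_rec\<close> are positive for k \<le> J < i. All
  constants of one pair i, k thus share a sign or vanish together.\<close>

lemma struct_const_pos_multiple:
  assumes "k \<le> J" "J \<le> i" "i \<le> n - 1" "k \<noteq> n - 1"
  shows "\<exists>q > 0. struct_const n i J k = q * struct_const n i k k"
  using assms
proof (induction J rule: dec_induct)
  case base
  then show ?case by (intro exI[of _ 1]) auto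
next
  case (step J)
  then obtain q where q: "q > 0" "struct_const n i J k = q * struct_const n i k k" by auto
  define x where "x = (of_int ((2 * int n - 2 - int k - int J) * (int J - int k + 1)) :: rat)"
  define y where "y = (of_int ((int i - int J) * (int i + int J + 1)) :: rat)"
  have "x > 0" "y > 0" unfolding x_def y_def of_int_0_less_iff
    using step by (auto intro!: mult_pos_pos)
  moreover have "x * struct_const n i (Suc J) k = y * struct_const n i J k"
    unfolding x_def y_def using step by (intro struct_const_rec) auto
  ultimately show ?case using q
    by (intro exI[of _ "y / x * q"]) (auto simp: field_simps)
qed

section \<open>Two special values of the structure constants\<close>

text \<open>The Pochhammer symbol is the product (a + 1)...(a + i) of the superdiagonal entries met
  between a and a + i.\<close>

lemma e_mat_pow_index:
  "a < n \<Longrightarrow> b < n \<Longrightarrow> (e_mat n ^\<^sub>m i) $$ (a, b) = (if b = a + i then of_nat (pochhammer (a + 1) i) else 0)"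
proof (induction i arbitrary: b)
  case 0
  then show ?case by (auto simp: e_mat_def)
next
  case (Suc i)
  have "(e_mat n ^\<^sub>m Suc i) $$ (a, b) = (\<Sum>c<n. (e_mat n ^\<^sub>m i) $$ (a, c) * e_mat n $$ (c, b))"
    using Suc.prems by (simp add: mult_mat_index[of _ n] pow_carrier_mat del: index_mult_mat)
  also have "\<dots> = (\<Sum>c<n. if c = a + i \<and> b = Suc c then of_nat (pochhammer (a + 1) i) * of_nat b else 0)"
    using Suc by (intro sum.cong) (auto simp: e_mat_def)
  also have "\<dots> = (if b = a + Suc i then of_nat (pochhammer (a + 1) (Suc i)) else 0)"
  proof (cases "b = a + Suc i")
    case True
    then show ?thesis using Suc.prems
      by (subst sum.remove[of _ "a + i"]) (auto simp: pochhammer_Suc algebra_simps intro!: sum.neutral)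
  qed (auto intro!: sum.neutral)
  finally show ?case .
qed

lemma commute_pow_mat:
  fixes A B :: "'a :: semiring_1 mat"
  assumes A: "A \<in> carrier_mat n n" and B: "B \<in> carrier_mat n n" and "A * B = B * A"
  shows "(A ^\<^sub>m i) * B = B * (A ^\<^sub>m i)"
proof (induction i)
  case (Suc i)
  have P: "A ^\<^sub>m i \<in> carrier_mat n n" using A by (rule pow_carrier_mat)
  have "A ^\<^sub>m Suc i * B = A ^\<^sub>m i * (A * B)" by (simp add: assoc_mult_mat[OF P A B])
  also have "\<dots> = (A ^\<^sub>m i * B) * A" unfolding assms(3) by (rule assoc_mult_mat[symmetric, OF P B A])
  also have "\<dots> = B * A ^\<^sub>m Suc i" unfolding Suc by (simp add: assoc_mult_mat[OF B P A])
  finally show ?case .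
qed (use A B in auto)

text \<open>As P commutes with A, P [A, B] = [A, P B], and commutators have trace zero.\<close>

lemma trace_mult_ad_commuting:
  assumes P: "P \<in> carrier_mat n n" and A: "A \<in> carrier_mat n n" and B: "B \<in> carrier_mat n n"
    and PA: "P * A = A * P"
  shows "(\<Sum>a<n. (P * ad A B) $$ (a, a)) = 0"
proof -
  have "P * ad A B = P * (A * B) - P * (B * A)"
    unfolding ad_def by (rule mult_minus_distrib_mat[OF P]) (use A B in auto)
  also have "P * (A * B) = A * (P * B)"
    using assoc_mult_mat[OF P A B] assoc_mult_mat[OF A P B] PA by simp
  also have "P * (B * A) = (P * B) * A" by (rule assoc_mult_mat[symmetric, OF P B A])
  finally have "P * ad A B = ad A (P * B)" by (simp add: ad_def)
  then show ?thesis using trace_ad[OF A mult_carrier_mat[OF P B]] by simp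
qed

lemma commute_of_ad_zero:
  assumes A: "A \<in> carrier_mat n n" and B: "B \<in> carrier_mat n n" and ad0: "ad A B = 0\<^sub>m n n"
  shows "A * B = B * A"
proof (rule eq_matI)
  fix a b assume ab: "a < dim_row (B * A)" "b < dim_col (B * A)"
  then have "ad A B $$ (a, b) = (A * B) $$ (a, b) - (B * A) $$ (a, b)"
    unfolding ad_def by (rule index_minus_mat(1))
  moreover have "a < n" "b < n" using ab A B by auto
  ultimately show "(A * B) $$ (a, b) = (B * A) $$ (a, b)" using ad0 by (simp del: index_mult_mat)
qed (use A B in auto)

text \<open>Pair the defining relation with P = e^i under the trace. The commutator pairs to zero
  because its second argument commutes with e, and so do the terms l > i, which lie in the image of
  \<open>ad (e_mat n)\<close>. What remains is the term l = i, whose vector pairs to a positive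
  number.\<close>

lemma struct_const_diag_zero:
  assumes i: "1 \<le> i" "i \<le> n - 2"
  shows "struct_const n i i i = 0"
proof -
  define P where "P = e_mat n ^\<^sub>m i"
  have P: "P \<in> carrier_mat n n" unfolding P_def by (rule pow_carrier_mat) simp
  let ?v = "v_elt n (n - 1 - i) (int n - 1 - int i)"
  let ?I = "{max 1 i..n - 1}"
  have v: "?v \<in> carrier_mat n n" using i by simp
  have "int (n - 1 - i) = int n - 1 - int i" using i by linarith
  \<comment> \<open>n - 1 - i is both the index and the weight of this vector, so it is the top of
    its string.\<close>
  then have "ad (e_mat n) ?v = 0\<^sub>m n n"
    using i ad_e_v_elt[of "n - 1 - i" n "int n - 1 - int i"] v_elt_top[of "n - 1 - i" n] by simp
  then have Pv: "P * ?v = ?v * P"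
    unfolding P_def using v by (intro commute_pow_mat commute_of_ad_zero) auto
  have Pe: "P * e_mat n = e_mat n * P"
    unfolding P_def by (rule commute_pow_mat[OF e_mat_carrier e_mat_carrier refl])
  define T where "T = (\<lambda>A :: complex mat. \<Sum>a<n. (P * A) $$ (a, a))"
  have T: "T A = (\<Sum>a<n. \<Sum>c<n. P $$ (a, c) * A $$ (c, a))" if "A \<in> carrier_mat n n" for A
    using that P by (simp add: T_def mult_mat_index[of _ n] del: index_mult_mat)
  have spec: "ad (binom_mat n (n - 1)) ?v
      = mat_sum n (\<lambda>l. of_rat (struct_const n l i i) \<cdot>\<^sub>m v_elt n l (- int i)) ?I"
    using struct_const_spec(1)[of i i n] i by (simp add: f_elt_eq)
  have "T (ad (binom_mat n (n - 1)) ?v) = - T (ad ?v (binom_mat n (n - 1)))"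
  proof -
    define Y where "Y = ad ?v (binom_mat n (n - 1))"
    have Y: "Y \<in> carrier_mat n n" unfolding Y_def using v by simp
    have "T ((-1) \<cdot>\<^sub>m Y) = - T Y"
      using Y by (simp add: T sum_negf)
    then show ?thesis
      using ad_skew[of "binom_mat n (n - 1)" n ?v] v unfolding Y_def by simp
  qed
  also have "T (ad ?v (binom_mat n (n - 1))) = 0"
    unfolding T_def by (rule trace_mult_ad_commuting[OF P v _ Pv]) simp
  finally have "T (ad (binom_mat n (n - 1)) ?v) = 0" by simp
  then have "0 = T (mat_sum n (\<lambda>l. of_rat (struct_const n l i i) \<cdot>\<^sub>m v_elt n l (- int i)) ?I)"
    unfolding spec by simp
  also have "\<dots> = (\<Sum>a<n. \<Sum>c<n. \<Sum>l\<in>?I. of_rat (struct_const n l i i) * (P $$ (a, c) * v_elt n l (- int i) $$ (c, a)))"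
  proof -
    have "dim_row (v_elt n l (- int i)) = n" "dim_col (v_elt n l (- int i)) = n" if "l \<in> ?I" for l
      using that carrier_matD[OF v_elt_carrier[of l n]] by auto
    then show ?thesis by (simp add: T sum_distrib_left algebra_simps)
  qed
  also have "\<dots> = (\<Sum>a<n. \<Sum>l\<in>?I. \<Sum>c<n. of_rat (struct_const n l i i) * (P $$ (a, c) * v_elt n l (- int i) $$ (c, a)))"
    by (intro sum.cong refl sum.swap)
  also have "\<dots> = (\<Sum>l\<in>?I. \<Sum>a<n. \<Sum>c<n. of_rat (struct_const n l i i) * (P $$ (a, c) * v_elt n l (- int i) $$ (c, a)))"
    by (rule sum.swap)
  also have "\<dots> = (\<Sum>l\<in>?I. of_rat (struct_const n l i i) * T (v_elt n l (- int i)))"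
    by (intro sum.cong refl, subst T) (auto simp: sum_distrib_left)
  also have "\<dots> = (\<Sum>l\<in>{i}. of_rat (struct_const n l i i) * T (v_elt n l (- int i)))"
  proof (rule sum.mono_neutral_right)
    show "\<forall>l\<in>?I - {i}. of_rat (struct_const n l i i) * T (v_elt n l (- int i)) = 0"
    proof
      fix l assume l: "l \<in> ?I - {i}"
      \<comment> \<open>For l > i the string reaches below weight -i.\<close>
      then have "v_elt n l (- int i) = ad (e_mat n) (v_elt n l (- int i - 1))"
        using i by (subst ad_e_v_elt) auto
      moreover have "T (ad (e_mat n) (v_elt n l (- int i - 1))) = 0"
        unfolding T_def using l i by (intro trace_mult_ad_commuting P Pe) auto
      ultimately show "of_rat (struct_const n l i i) * T (v_elt n l (- int i)) = 0" by simp
    qed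
  qed (use i in auto)
  also have "\<dots> = of_rat (struct_const n i i i) * T (binom_mat n i)"
    using i by (simp add: v_elt_lowest)
  finally have "of_rat (struct_const n i i i) * T (binom_mat n i) = 0" by simp
  moreover have "T (binom_mat n i) \<noteq> 0"
  proof -
    let ?g = "\<lambda>a c. if c = a + i then pochhammer (a + 1) i * ((n - 1 - a) choose i) else 0"
    \<comment> \<open>The trace of e^i f_i is a sum of natural numbers, and the term at (0, i) is
      positive.\<close>
    have "T (binom_mat n i) = (\<Sum>a<n. \<Sum>c<n. of_nat (?g a c))"
      by (subst T) (auto simp: P_def e_mat_pow_index binom_mat_def intro!: sum.cong simp del: of_nat_diff)
    also have "\<dots> = of_nat (\<Sum>a<n. \<Sum>c<n. ?g a c)" by (simp only: of_nat_sum)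
    also have "(\<Sum>a<n. \<Sum>c<n. ?g a c) > 0"
    proof (rule sum_pos2[of _ 0])
      show "(\<Sum>c<n. ?g 0 c) > 0"
        by (rule sum_pos2[of _ i]) (use i in \<open>auto simp: pochhammer_pos\<close>)
    qed (use i in \<open>auto intro!: sum_nonneg\<close>)
    then have "(of_nat (\<Sum>a<n. \<Sum>c<n. ?g a c) :: complex) \<noteq> 0" by (simp only: of_nat_eq_0_iff)
    finally show ?thesis .
  qed
  ultimately show ?thesis by simp
qed

text \<open>The vector \<open>v_elt n 1 1\<close> is [e, [e, f]] = [e, h] = -2e, and bracketing the
  lowest vector with it gives 2 [e, f_{n-1}], twice the second vector of the longest string.\<close>

lemma struct_const_top:
  assumes n: "n \<ge> 2"
  shows "struct_const n (n - 1) (n - 2) (n - 2) = 2"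
proof -
  let ?F = "binom_mat n (n - 1)"
  have f1: "binom_mat n 1 = f_mat n"
    by (intro eq_matI) (auto simp: binom_mat_def f_mat_def)
  have "v_elt n 1 1 = ad (e_mat n) (ad (e_mat n) (f_mat n))"
    using n by (simp add: v_elt_eq e_string_def f1[simplified] numeral_2_eq_2)
  also have "\<dots> = (-1) \<cdot>\<^sub>m ad (h_mat n) (e_mat n)"
    unfolding ad_e_f by (rule ad_skew[of _ n]) auto
  also have "ad (h_mat n) (e_mat n) = 2 \<cdot>\<^sub>m e_mat n"
    using ad_h_of_weight[OF of_weight_e] by simp
  finally have v11: "v_elt n 1 1 = (-2) \<cdot>\<^sub>m e_mat n" by (simp add: smult_smult_mat)
  have "ad ?F (v_elt n 1 1) = (-2) \<cdot>\<^sub>m ad ?F (e_mat n)"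
    unfolding v11 by (rule ad_smult[of _ n]) auto
  also have "\<dots> = 2 \<cdot>\<^sub>m ad (e_mat n) ?F"
    using ad_skew[of ?F n "e_mat n"] by (simp add: smult_smult_mat)
  also have "ad (e_mat n) ?F = v_elt n (n - 1) (- int (n - 2))"
  proof -
    have "- int (n - 1) + 1 = - int (n - 2)" using n by linarith
    then show ?thesis using n ad_e_v_elt[of "n - 1" n "- int (n - 1)"] v_elt_lowest[of "n - 1" n]
      by (simp only:)
  qed
  also have "2 \<cdot>\<^sub>m v_elt n (n - 1) (- int (n - 2))
      = mat_sum n (\<lambda>l. (if l = n - 1 then 2 else 0) \<cdot>\<^sub>m v_elt n l (- int (n - 2))) {n - 1}"
    using n by (subst mat_sum_singleton) auto
  \<comment> \<open>Padding by zero coefficients reaches the index range of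
    \<open>struct_const_spec\<close>.\<close>
  also have "\<dots> = mat_sum n (\<lambda>l. (if l = n - 1 then 2 else 0) \<cdot>\<^sub>m v_elt n l (- int (n - 2))) {max 1 (n - 2)..n - 1}"
    by (rule mat_sum_mono_neutral[symmetric]) (use n in \<open>auto intro!: smult_zero_mat v_elt_carrier\<close>)
  finally have "mat_sum n (\<lambda>l. of_rat (struct_const n l (n - 2) (n - 2)) \<cdot>\<^sub>m v_elt n l (- int (n - 2))) {max 1 (n - 2)..n - 1}
      = mat_sum n (\<lambda>l. (if l = n - 1 then 2 else 0) \<cdot>\<^sub>m v_elt n l (- int (n - 2))) {max 1 (n - 2)..n - 1}"
    using struct_const_spec(1)[of "n - 2" "n - 2" n] n
    by (simp add: f_elt_eq of_nat_diff numeral_2_eq_2 Suc_diff_Suc)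
  from v_elt_unique[OF this[folded string_indices_uminus], of "n - 1"]
  have "(of_rat (struct_const n (n - 1) (n - 2) (n - 2)) :: complex) = of_rat 2"
    using n by (simp add: string_indices_def)
  then show ?thesis by (simp only: of_rat_eq_iff)
qed

subsection \<open>The isomonodromy equation in coordinates\<close>

lemma higher_deriv_sum:
  assumes "finite I" "\<And>i. i \<in> I \<Longrightarrow> f i holomorphic_on UNIV"
  shows "(deriv ^^ m) (\<lambda>z. \<Sum>i\<in>I. f i z) = (\<lambda>z. \<Sum>i\<in>I. (deriv ^^ m) (f i) z)"
  using assms
proof (induction I rule: finite_induct)
  case empty
  then show ?case by (auto simp: fun_eq_iff)
next
  case (insert i I)
  have "(\<lambda>z. \<Sum>i\<in>I. f i z) holomorphic_on UNIV"
    using insert by (intro holomorphic_on_sum) auto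
  with insert show ?case
    by (auto simp: fun_eq_iff higher_deriv_add[of _ UNIV])
qed

text \<open>The recursion is unrolled N times; the source G t enters at step t + 1 and is
  differentiated in the N - 1 - t steps left.\<close>

lemma higher_deriv_recursion:
  fixes x G :: "nat \<Rightarrow> complex \<Rightarrow> complex"
  assumes x: "\<And>t. t \<le> N \<Longrightarrow> x t holomorphic_on UNIV"
    and G: "\<And>t. t < N \<Longrightarrow> G t holomorphic_on UNIV"
    and rec: "\<And>t z. t < N \<Longrightarrow> deriv (x t) z = x (Suc t) z + G t z"
  shows "(deriv ^^ N) (x 0) z = x N z + (\<Sum>t<N. (deriv ^^ (N - 1 - t)) (G t) z)"
  using assms
proof (induction N arbitrary: z)
  case (Suc N)
  have "(deriv ^^ N) (x 0) = (\<lambda>z. x N z + (\<Sum>t<N. (deriv ^^ (N - 1 - t)) (G t) z))"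
    using Suc by (intro ext) auto
  then have "(deriv ^^ Suc N) (x 0) z = deriv (\<lambda>z. x N z + (\<Sum>t<N. (deriv ^^ (N - 1 - t)) (G t) z)) z"
    by simp
  also have "\<dots> = deriv (x N) z + (\<Sum>t<N. deriv ((deriv ^^ (N - 1 - t)) (G t)) z)"
  proof (rule DERIV_imp_deriv, rule DERIV_add)
    show "(x N has_field_derivative deriv (x N) z) (at z)"
      using Suc.prems(1)[of N] by (intro holomorphic_derivI[of _ UNIV]) auto
    show "((\<lambda>z. \<Sum>t<N. (deriv ^^ (N - 1 - t)) (G t) z) has_field_derivative
        (\<Sum>t<N. deriv ((deriv ^^ (N - 1 - t)) (G t)) z)) (at z)"
      using Suc.prems(2)
      by (intro DERIV_sum holomorphic_derivI[of _ UNIV] holomorphic_higher_deriv) auto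
  qed
  also have "(\<Sum>t<N. deriv ((deriv ^^ (N - 1 - t)) (G t)) z) = (\<Sum>t<N. (deriv ^^ (N - t)) (G t) z)"
  proof (rule sum.cong)
    fix t assume "t \<in> {..<N}"
    then have "N - t = Suc (N - 1 - t)" by auto
    then show "deriv ((deriv ^^ (N - 1 - t)) (G t)) z = (deriv ^^ (N - t)) (G t) z" by simp
  qed simp
  also have "deriv (x N) z = x (Suc N) z + G N z" using Suc.prems(3) by simp
  finally show ?case by simp
qed simp

text \<open>Every summand has i - k derivatives in total, so the Leibniz rule yields the terms of
  weight i - k, with non-negative coefficients.\<close>

lemma weight_expr_higher_deriv_sum:
  fixes a :: "nat \<Rightarrow> real"
  assumes "k \<le> i" and a: "\<And>J. J \<in> {k..i} \<Longrightarrow> a J \<ge> 0" "a k > 0"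
    and f: "f holomorphic_on UNIV" and g: "g holomorphic_on UNIV"
  shows "weight_expr (i - k) f g
     (\<lambda>z. \<Sum>J=k..i. of_real (a J) * (deriv ^^ (i - J)) (\<lambda>z. f z * (deriv ^^ (J - k)) g z) z)"
proof -
  \<comment> \<open>The total coefficient of the product of the (i - k - j)-th derivative of f and
    the j-th derivative of g.\<close>
  define c where "c j = (\<Sum>J=k..i. a J * real ((i - J) choose (i - k - j)))" for j
  have "(\<Sum>J=k..i. of_real (a J) * (deriv ^^ (i - J)) (\<lambda>z. f z * (deriv ^^ (J - k)) g z) z)
      = (\<Sum>j\<le>i - k. of_real (c j) * (deriv ^^ (i - k - j)) f z * (deriv ^^ j) g z)" for z
  proof -
    have "(deriv ^^ (i - J)) (\<lambda>z. f z * (deriv ^^ (J - k)) g z) z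
        = (\<Sum>j\<le>i - k. of_nat ((i - J) choose (i - k - j)) * (deriv ^^ (i - k - j)) f z * (deriv ^^ j) g z)"
      if J: "J \<in> {k..i}" for J
    proof -
      have "(deriv ^^ (i - J)) (\<lambda>z. f z * (deriv ^^ (J - k)) g z) z
          = (\<Sum>t = 0..i - J. of_nat ((i - J) choose t) * (deriv ^^ t) f z * (deriv ^^ (i - J - t)) ((deriv ^^ (J - k)) g) z)"
        using f g by (intro higher_deriv_mult[of _ UNIV] holomorphic_higher_deriv) auto
      also have "\<dots> = (\<Sum>t = 0..i - J. of_nat ((i - J) choose t) * (deriv ^^ t) f z * (deriv ^^ (i - k - t)) g z)"
      proof (intro sum.cong refl)
        fix t assume "t \<in> {0..i - J}"
        then have e: "i - k - t = (i - J - t) + (J - k)" using J by auto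
        show "of_nat ((i - J) choose t) * (deriv ^^ t) f z * (deriv ^^ (i - J - t)) ((deriv ^^ (J - k)) g) z
            = of_nat ((i - J) choose t) * (deriv ^^ t) f z * (deriv ^^ (i - k - t)) g z"
          unfolding e funpow_add by simp
      qed
      \<comment> \<open>Binomials with t > i - J vanish, so all J can share the range up to i -
        k.\<close>
      also have "\<dots> = (\<Sum>t\<le>i - k. of_nat ((i - J) choose t) * (deriv ^^ t) f z * (deriv ^^ (i - k - t)) g z)"
        using J by (intro sum.mono_neutral_left) auto
      also have "\<dots> = (\<Sum>j\<le>i - k. of_nat ((i - J) choose (i - k - j)) * (deriv ^^ (i - k - j)) f z * (deriv ^^ j) g z)"
        by (rule sum.reindex_bij_witness[of _ "\<lambda>j. i - k - j" "\<lambda>j. i - k - j"])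
          (auto simp del: diff_diff_left)
      finally show ?thesis .
    qed
    then have "(\<Sum>J=k..i. of_real (a J) * (deriv ^^ (i - J)) (\<lambda>z. f z * (deriv ^^ (J - k)) g z) z)
        = (\<Sum>J=k..i. \<Sum>j\<le>i - k. of_real (a J) *
            (of_nat ((i - J) choose (i - k - j)) * (deriv ^^ (i - k - j)) f z * (deriv ^^ j) g z))"
      by (simp add: sum_distrib_left)
    also have "\<dots> = (\<Sum>j\<le>i - k. \<Sum>J=k..i. of_real (a J) *
            (of_nat ((i - J) choose (i - k - j)) * (deriv ^^ (i - k - j)) f z * (deriv ^^ j) g z))"
      by (rule sum.swap)
    also have "\<dots> = (\<Sum>j\<le>i - k. of_real (c j) * (deriv ^^ (i - k - j)) f z * (deriv ^^ j) g z)"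
      by (simp add: c_def sum_distrib_right mult.assoc)
    finally show ?thesis .
  qed
  moreover have "c j \<ge> 0" for j
    unfolding c_def using a by (intro sum_nonneg) auto
  \<comment> \<open>At j = i - k each binomial is C(i - J, 0) = 1, and the term J = k is
    \<open>a k > 0\<close>.\<close>
  moreover have "c (i - k) > 0"
    unfolding c_def by (rule sum_pos2[of _ k]) (use assms in auto)
  ultimately show ?thesis
    unfolding weight_expr_def by (intro exI[of _ c]) (auto intro!: exI[of _ "i - k"])
qed

section \<open>Weight components of the solution\<close>

text \<open>An entry sees only the summand of its own weight. The shift s is for components already
  bracketed with a matrix of weight s.\<close>

lemma mat_sum_weight_component:
  assumes "finite J" "\<And>j. j \<in> J \<Longrightarrow> of_weight n (j + s) (M j)"
    and "a < n" "b < n" "int b - int a - s \<in> J"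
  shows "mat_sum n M J $$ (a, b) = M (int b - int a - s) $$ (a, b)"
proof -
  have "(\<Sum>j\<in>J. M j $$ (a, b)) = (\<Sum>j\<in>{int b - int a - s}. M j $$ (a, b))"
    using assms by (intro sum.mono_neutral_right) (auto intro!: of_weight_index)
  with assms show ?thesis by simp
qed

definition Omega_part :: "nat \<Rightarrow> (nat \<Rightarrow> int \<Rightarrow> complex \<Rightarrow> complex) \<Rightarrow> int \<Rightarrow> complex \<Rightarrow> complex mat" where
  "Omega_part n \<omega> j z = mat_sum n (\<lambda>l. \<omega> l j z \<cdot>\<^sub>m v_elt n l j) (string_indices n j)"

lemma of_weight_Omega_part: "of_weight n j (Omega_part n \<omega> j z)"
  unfolding Omega_part_def
  by (intro of_weight_mat_sum of_weight_smult of_weight_v_elt) (auto dest: string_indicesD)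

lemma Omega_part_carrier [simp]: "Omega_part n \<omega> j z \<in> carrier_mat n n"
  by (simp add: Omega_part_def)

text \<open>
  The summands vanish outside \<open>- (n - 1)..n - 1\<close>; the range is wider so that it also contains all
  weights shifted by up to n.
\<close>

lemma Omega_mat_eq:
  "Omega_mat n \<omega> z = mat_sum n (\<lambda>j. Omega_part n \<omega> j z) {- 3 * int n..3 * int n}"
proof (rule eq_matI)
  let ?B = "{- 3 * int n..3 * int n}"
  fix a b assume "a < dim_row (mat_sum n (\<lambda>j. Omega_part n \<omega> j z) ?B)"
    "b < dim_col (mat_sum n (\<lambda>j. Omega_part n \<omega> j z) ?B)"
  then have ab: "a < n" "b < n" by (auto simp: mat_sum_def)
  have "Omega_mat n \<omega> z $$ (a, b)
      = (\<Sum>i\<in>{1..n - 1}. \<Sum>j\<in>{- int i..int i}. (\<omega> i j z \<cdot>\<^sub>m v_elt n i j) $$ (a, b))"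
    using ab by (simp add: Omega_mat_def)
  also have "\<dots> = (\<Sum>i\<in>{1..n - 1}. \<Sum>j | j \<in> ?B \<and> \<bar>j\<bar> \<le> int i. (\<omega> i j z \<cdot>\<^sub>m v_elt n i j) $$ (a, b))"
    by (intro sum.cong) auto
  also have "\<dots> = (\<Sum>j\<in>?B. \<Sum>i | i \<in> {1..n - 1} \<and> \<bar>j\<bar> \<le> int i. (\<omega> i j z \<cdot>\<^sub>m v_elt n i j) $$ (a, b))"
    by (rule sum.swap_restrict) auto
  finally show "Omega_mat n \<omega> z $$ (a, b) = mat_sum n (\<lambda>j. Omega_part n \<omega> j z) ?B $$ (a, b)"
    using ab by (simp add: Omega_part_def string_indices_def)
qed (auto simp: mat_sum_def Omega_mat_def)

lemma ad_Omega_index: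
  assumes "of_weight n s A" "\<bar>s\<bar> \<le> int n" "a < n" "b < n"
  shows "ad A (Omega_mat n \<omega> z) $$ (a, b) = ad A (Omega_part n \<omega> (int b - int a - s) z) $$ (a, b)"
proof -
  have "ad A (Omega_mat n \<omega> z) = mat_sum n (\<lambda>j. ad A (Omega_part n \<omega> j z)) {- 3 * int n..3 * int n}"
    unfolding Omega_mat_eq by (rule ad_mat_sum[OF of_weight_carrier[OF assms(1)]]) simp
  also have "\<dots> $$ (a, b) = ad A (Omega_part n \<omega> (int b - int a - s) z) $$ (a, b)"
    using of_weight_ad[OF assms(1) of_weight_Omega_part] assms
    by (intro mat_sum_weight_component) (auto simp: add.commute)
  finally show ?thesis .
qed

text \<open>Each coefficient moves one weight up its string. The string l = -j receives nothing,
  since it begins in weight j, and the string l = j - 1 ends, by \<open>v_elt_top\<close>.\<close>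

lemma ad_e_Omega_part:
  "ad (e_mat n) (Omega_part n \<omega> (j - 1) z)
     = mat_sum n (\<lambda>l. (if - int l < j then \<omega> l (j - 1) z else 0) \<cdot>\<^sub>m v_elt n l j) (string_indices n j)"
proof -
  let ?x = "\<lambda>l. if - int l < j \<and> j - 1 \<le> int l then \<omega> l (j - 1) z else 0"
  let ?U = "string_indices n (j - 1) \<union> string_indices n j"
  have "ad (e_mat n) (Omega_part n \<omega> (j - 1) z)
      = mat_sum n (\<lambda>l. ad (e_mat n) (\<omega> l (j - 1) z \<cdot>\<^sub>m v_elt n l (j - 1))) (string_indices n (j - 1))"
    unfolding Omega_part_def by (intro ad_mat_sum e_mat_carrier mat_sum_v_elt_carrier_smult)
  also have "\<dots> = mat_sum n (\<lambda>l. ?x l \<cdot>\<^sub>m v_elt n l j) (string_indices n (j - 1))"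
    using string_indicesD[of _ n "j - 1"]
    by (intro mat_sum_cong refl)
      (auto simp: ad_smult[OF e_mat_carrier v_elt_carrier] ad_e_v_elt)
  also have "\<dots> = mat_sum n (\<lambda>l. ?x l \<cdot>\<^sub>m v_elt n l j) ?U"
    by (rule mat_sum_mono_neutral[symmetric]) (auto simp: string_indices_def intro!: smult_zero_mat v_elt_carrier)
  also have "\<dots> = mat_sum n (\<lambda>l. ?x l \<cdot>\<^sub>m v_elt n l j) (string_indices n j)"
  proof (rule mat_sum_mono_neutral)
    fix l assume l: "l \<in> ?U - string_indices n j"
    then have "j = int l + 1 \<and> 1 \<le> l \<and> l < n" by (auto simp: string_indices_def)
    then show "?x l \<cdot>\<^sub>m v_elt n l j = 0\<^sub>m n n" by (auto simp: v_elt_top)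
  qed auto
  also have "\<dots> = mat_sum n (\<lambda>l. (if - int l < j then \<omega> l (j - 1) z else 0) \<cdot>\<^sub>m v_elt n l j) (string_indices n j)"
    by (intro mat_sum_cong) (auto simp: string_indices_def)
  finally show ?thesis .
qed

text \<open>The strings meeting weight n - 1 - J are those of index n - 1 - k with k \<le> J; the
  index must be at least 1, whence the bound n - 2. Each is then expanded by
  \<open>struct_const_spec\<close>.\<close>

lemma ad_lowest_Omega_part:
  assumes n: "n \<ge> 2" and J: "J \<le> n - 1"
  shows "ad (f_elt n (n - 1)) (Omega_part n \<omega> (int n - 1 - int J) z)
     = mat_sum n (\<lambda>l. (\<Sum>k\<le>min J (n - 2). of_rat (struct_const n l J k) * \<omega> (n - 1 - k) (int n - 1 - int J) z)
         \<cdot>\<^sub>m v_elt n l (- int J)) (string_indices n (- int J))"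
    (is "_ = mat_sum n (\<lambda>l. (\<Sum>k\<le>?m. ?c l k * ?w k) \<cdot>\<^sub>m _) ?I")
proof -
  let ?F = "f_elt n (n - 1)" and ?j = "int n - 1 - int J"
  have F: "?F \<in> carrier_mat n n" using n by (simp add: f_elt_eq)
  have I: "string_indices n ?j = (\<lambda>k. n - 1 - k) ` {..?m}"
  proof (intro equalityI subsetI)
    fix l assume "l \<in> string_indices n ?j"
    then show "l \<in> (\<lambda>k. n - 1 - k) ` {..?m}"
      by (intro image_eqI[of _ _ "n - 1 - l"]) (auto simp: string_indices_def)
  qed (use n J in \<open>auto simp: string_indices_def\<close>)
  have inj: "inj_on (\<lambda>k. n - 1 - k) {..?m}" using n by (auto simp: inj_on_def)
  have dim: "dim_row (v_elt n l (- int J)) = n" "dim_col (v_elt n l (- int J)) = n" if "l \<in> ?I" for l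
    using carrier_matD[OF v_elt_carrier[OF string_indicesD(1,2)[OF that]]] by auto
  have "ad ?F (Omega_part n \<omega> ?j z)
      = mat_sum n (\<lambda>l. ad ?F (\<omega> l ?j z \<cdot>\<^sub>m v_elt n l ?j)) (string_indices n ?j)"
    unfolding Omega_part_def by (intro ad_mat_sum F mat_sum_v_elt_carrier_smult)
  also have "\<dots> = mat_sum n (\<lambda>k. ad ?F (?w k \<cdot>\<^sub>m v_elt n (n - 1 - k) ?j)) {..?m}"
    unfolding I mat_sum_def by (simp only: sum.reindex[OF inj] o_def)
  also have "\<dots> = mat_sum n (\<lambda>k. ?w k \<cdot>\<^sub>m mat_sum n (\<lambda>l. ?c l k \<cdot>\<^sub>m v_elt n l (- int J)) ?I) {..?m}"
  proof (rule mat_sum_cong)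
    fix k assume k: "k \<in> {..?m}"
    have "ad ?F (?w k \<cdot>\<^sub>m v_elt n (n - 1 - k) ?j) = ?w k \<cdot>\<^sub>m ad ?F (v_elt n (n - 1 - k) ?j)"
      using k n by (intro ad_smult[OF F v_elt_carrier]) auto
    also have "ad ?F (v_elt n (n - 1 - k) ?j) = mat_sum n (\<lambda>l. ?c l k \<cdot>\<^sub>m v_elt n l (- int J)) ?I"
      unfolding string_indices_uminus using k n J by (intro struct_const_spec(1)) auto
    finally show "ad ?F (?w k \<cdot>\<^sub>m v_elt n (n - 1 - k) ?j)
        = ?w k \<cdot>\<^sub>m mat_sum n (\<lambda>l. ?c l k \<cdot>\<^sub>m v_elt n l (- int J)) ?I" .
  qed simp
  also have "\<dots> = mat_sum n (\<lambda>l. (\<Sum>k\<le>?m. ?c l k * ?w k) \<cdot>\<^sub>m v_elt n l (- int J)) ?I"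
  proof (rule eq_matI)
    fix a b
    assume "a < dim_row (mat_sum n (\<lambda>l. (\<Sum>k\<le>?m. ?c l k * ?w k) \<cdot>\<^sub>m v_elt n l (- int J)) ?I)"
      "b < dim_col (mat_sum n (\<lambda>l. (\<Sum>k\<le>?m. ?c l k * ?w k) \<cdot>\<^sub>m v_elt n l (- int J)) ?I)"
    then have ab: "a < n" "b < n" by (auto simp: mat_sum_def)
    have "(\<Sum>k\<le>?m. ?w k * (\<Sum>l\<in>?I. ?c l k * v_elt n l (- int J) $$ (a, b)))
        = (\<Sum>l\<in>?I. (\<Sum>k\<le>?m. ?c l k * ?w k) * v_elt n l (- int J) $$ (a, b))"
      unfolding sum_distrib_left sum_distrib_right by (subst sum.swap) (simp add: ac_simps)
    then show "mat_sum n (\<lambda>k. ?w k \<cdot>\<^sub>m mat_sum n (\<lambda>l. ?c l k \<cdot>\<^sub>m v_elt n l (- int J)) ?I) {..?m} $$ (a, b)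
        = mat_sum n (\<lambda>l. (\<Sum>k\<le>?m. ?c l k * ?w k) \<cdot>\<^sub>m v_elt n l (- int J)) ?I $$ (a, b)"
      using ab by (simp add: dim carrier_matD[OF mat_sum_carrier] del: diff_diff_left)
  qed (auto simp: mat_sum_def)
  finally show ?thesis .
qed

text \<open>The coefficients of \<open>v_elt n l j\<close> on both sides of the equation. The terms
  come from raising by e, from the inhomogeneity and from the bracket with the lowest
  vector.\<close>

lemma isomonodromy_coefficients:
  assumes n: "n \<ge> 2"
    and hol: "\<And>i j. i \<in> {1..n - 1} \<Longrightarrow> j \<in> {- int i..int i} \<Longrightarrow> \<omega> i j holomorphic_on UNIV"
    and sol: "isomonodromy_solution n p pd (Omega_mat n \<omega>)"
    and l: "l \<in> string_indices n j"
  shows "deriv (\<omega> l j) z = (if - int l < j then \<omega> l (j - 1) z else 0)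
     + ((if l = n - 1 \<and> j = - int (n - 1) then poly pd z else 0)
     + (if j \<le> 0 then poly p z * (\<Sum>k\<le>min (nat (- j)) (n - 2).
           of_rat (struct_const n l (nat (- j)) k) * \<omega> (n - 1 - k) (int n - 1 + j) z) else 0))"
proof -
  let ?F = "f_elt n (n - 1)"
  have F: "of_weight n (- int (n - 1)) ?F" "?F \<in> carrier_mat n n"
    using n of_weight_binom_mat[of n "n - 1"] by (auto simp: f_elt_eq)
  define y1 where "y1 l = (if - int l < j then \<omega> l (j - 1) z else 0)" for l
  define y2 where "y2 l = (if l = n - 1 \<and> j = - int (n - 1) then poly pd z else 0)" for l
  define y3 where "y3 l = (if j \<le> 0 then \<Sum>k\<le>min (nat (- j)) (n - 2).
           of_rat (struct_const n l (nat (- j)) k) * \<omega> (n - 1 - k) (int n - 1 + j) z else 0)" for l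
  define S where "S = (\<lambda>y. mat_sum n (\<lambda>l. y l \<cdot>\<^sub>m v_elt n l j) (string_indices n j))"
  have wS: "of_weight n j (S y)" for y
    unfolding S_def by (intro of_weight_mat_sum of_weight_smult of_weight_v_elt) (auto dest: string_indicesD)
  have dim: "dim_row (v_elt n l j) = n" "dim_col (v_elt n l j) = n" if "l \<in> string_indices n j" for l
    using carrier_matD[OF v_elt_carrier[OF string_indicesD(1,2)[OF that]]] by auto
  have S_index: "S y $$ (a, b) = (\<Sum>l\<in>string_indices n j. y l * v_elt n l j $$ (a, b))"
    if "a < n" "b < n" for y a b
    using that by (simp add: S_def dim)
  have S1: "ad (e_mat n) (Omega_part n \<omega> (j - 1) z) = S y1"
    unfolding S_def y1_def by (rule ad_e_Omega_part)
  \<comment> \<open>The lowest vector is itself the basis vector of index n - 1 and weight -(n - 1),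
    so it feeds one coefficient only.\<close>
  have S2: "S y2 $$ (a, b) = poly pd z * ?F $$ (a, b)" if ab: "a < n" "b < n" "int b - int a = j" for a b
  proof (cases "j = - int (n - 1)")
    case True
    have "S y2 $$ (a, b) = (\<Sum>l\<in>{n - 1}. y2 l * v_elt n l j $$ (a, b))"
      unfolding S_index[OF ab(1,2)] using n True
      by (intro sum.mono_neutral_right) (auto simp: y2_def string_indices_def)
    with True n show ?thesis by (simp add: y2_def v_elt_lowest f_elt_eq del: of_nat_diff)
  next
    case False
    then have "?F $$ (a, b) = 0" using of_weight_index[OF F(1)] ab by blast
    with False ab show ?thesis by (simp add: S_index y2_def)
  qed
  have S3: "ad ?F (Omega_part n \<omega> (j + int (n - 1)) z) = S y3"
  proof (cases "j \<le> 0")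
    case True
    define J where "J = nat (- j)"
    have j: "j = - int J" "J \<le> n - 1" using True string_indicesD[OF l] by (auto simp: J_def)
    have e: "j + int (n - 1) = int n - 1 - int J" "int n - 1 + j = int n - 1 - int J" "nat (- j) = J"
      using j n by linarith+
    show ?thesis
      unfolding S_def y3_def e using ad_lowest_Omega_part[OF n j(2), of \<omega> z] True by (simp add: j(1))
  next
    case False
    \<comment> \<open>For j > 0 the source weight would exceed n - 1, the highest one
      present.\<close>
    have "string_indices n (j + int (n - 1)) = {}" using False by (auto simp: string_indices_def)
    then have "Omega_part n \<omega> (j + int (n - 1)) z = 0\<^sub>m n n"
      by (intro eq_matI) (auto simp: Omega_part_def mat_sum_def)
    moreover have "S y3 = 0\<^sub>m n n"
      by (rule of_weight_eqI[OF wS of_weight_zero]) (use False in \<open>auto simp: S_index y3_def\<close>)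
    ultimately show ?thesis using F by simp
  qed
  have "S (\<lambda>l. deriv (\<omega> l j) z) = S (\<lambda>l. y1 l + (y2 l + poly p z * y3 l))"
  proof (rule of_weight_eqI[OF wS wS])
    fix a b assume ab: "a < n" "b < n" "int b - int a = j"
    have Om: "Omega_mat n \<omega> w $$ (a, b) = (\<Sum>l\<in>string_indices n j. \<omega> l j w * v_elt n l j $$ (a, b))" for w
    proof -
      have "Omega_mat n \<omega> w $$ (a, b) = Omega_part n \<omega> (int b - int a - 0) w $$ (a, b)"
        unfolding Omega_mat_eq using ab of_weight_Omega_part
        by (intro mat_sum_weight_component) auto
      then show ?thesis using ab by (simp add: Omega_part_def dim)
    qed
    \<comment> \<open>The entry is differentiated through its coefficients and through the equation;
      the two derivatives agree.\<close>
    have "((\<lambda>w. Omega_mat n \<omega> w $$ (a, b)) has_field_derivative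
        (\<Sum>l\<in>string_indices n j. deriv (\<omega> l j) z * v_elt n l j $$ (a, b))) (at z)"
      unfolding Om
    proof (intro DERIV_sum DERIV_cmult_right holomorphic_derivI[of _ UNIV] hol)
      fix l assume "l \<in> string_indices n j"
      then show "l \<in> {1..n - 1}" "j \<in> {- int l..int l}" by (auto simp: string_indices_def)
    qed auto
    moreover have "((\<lambda>w. Omega_mat n \<omega> w $$ (a, b)) has_field_derivative
        (poly pd z \<cdot>\<^sub>m ?F + ad (e_mat n) (Omega_mat n \<omega> z) + poly p z \<cdot>\<^sub>m ad ?F (Omega_mat n \<omega> z)) $$ (a, b)) (at z)"
      using sol ab unfolding isomonodromy_solution_def mat_has_deriv_def by blast
    ultimately have "(\<Sum>l\<in>string_indices n j. deriv (\<omega> l j) z * v_elt n l j $$ (a, b))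
        = (poly pd z \<cdot>\<^sub>m ?F + ad (e_mat n) (Omega_mat n \<omega> z) + poly p z \<cdot>\<^sub>m ad ?F (Omega_mat n \<omega> z)) $$ (a, b)"
      by (rule DERIV_unique)
    also have "\<dots> = poly pd z * ?F $$ (a, b) + ad (e_mat n) (Omega_mat n \<omega> z) $$ (a, b)
        + poly p z * ad ?F (Omega_mat n \<omega> z) $$ (a, b)"
    proof -
      have O: "Omega_mat n \<omega> z \<in> carrier_mat n n" by (simp add: Omega_mat_def)
      show ?thesis
        using ab carrier_matD[OF F(2)] carrier_matD[OF ad_carrier[OF F(2) O]]
          carrier_matD[OF ad_carrier[OF e_mat_carrier O]] by simp
    qed
    also have "ad (e_mat n) (Omega_mat n \<omega> z) $$ (a, b) = S y1 $$ (a, b)"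
      using ab n by (subst ad_Omega_index[OF of_weight_e]) (auto simp: S1)
    also have "ad ?F (Omega_mat n \<omega> z) $$ (a, b) = S y3 $$ (a, b)"
      using ab n by (subst ad_Omega_index[OF F(1)]) (auto simp: S3[symmetric] simp del: of_nat_diff)
    also have "poly pd z * ?F $$ (a, b) = S y2 $$ (a, b)" using S2[OF ab] by simp
    finally show "S (\<lambda>l. deriv (\<omega> l j) z) $$ (a, b) = S (\<lambda>l. y1 l + (y2 l + poly p z * y3 l)) $$ (a, b)"
      using ab by (simp add: S_index algebra_simps sum.distrib sum_distrib_left)
  qed
  from v_elt_unique[OF this[unfolded S_def] l] show ?thesis
    by (simp add: y1_def y2_def y3_def)
qed

section \<open>Iteration along a string\<close>

text \<open>Only coefficients of positive weight are differentiated here; at these weights the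
  equation has no source and just lowers the weight by one.\<close>

lemma omega_higher_deriv:
  assumes n: "n \<ge> 2"
    and hol: "\<And>i j. i \<in> {1..n - 1} \<Longrightarrow> j \<in> {- int i..int i} \<Longrightarrow> \<omega> i j holomorphic_on UNIV"
    and sol: "isomonodromy_solution n p pd (Omega_mat n \<omega>)"
    and l: "l \<in> {1..n - 1}" and m: "m \<le> l"
  shows "(deriv ^^ m) (\<omega> l (int l)) = \<omega> l (int l - int m)"
proof
  fix z
  have "(deriv ^^ m) (\<omega> l (int l - int 0)) z
      = \<omega> l (int l - int m) z + (\<Sum>t<m. (deriv ^^ (m - 1 - t)) (\<lambda>_. 0) z)"
  proof (rule higher_deriv_recursion)
    fix t z assume t: "t < m"
    have "deriv (\<omega> l (int l - int t)) z = \<omega> l (int l - int t - 1) z"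
      using t l m by (subst isomonodromy_coefficients[OF n hol sol]) (auto simp: string_indices_def)
    then show "deriv (\<omega> l (int l - int t)) z = \<omega> l (int l - int (Suc t)) z + 0" by (simp add: algebra_simps)
  qed (use l m in \<open>auto intro!: hol\<close>)
  then show "(deriv ^^ m) (\<omega> l (int l)) z = \<omega> l (int l - int m) z" by simp
qed

text \<open>Differentiating 2i + 1 times runs down the whole string and past its end. At step t = i
  + J the source of weight -J enters and is differentiated i - J more times.\<close>

lemma omega_main:
  assumes n: "n \<ge> 2"
    and hol: "\<And>i j. i \<in> {1..n - 1} \<Longrightarrow> j \<in> {- int i..int i} \<Longrightarrow> \<omega> i j holomorphic_on UNIV"
    and sol: "isomonodromy_solution n p pd (Omega_mat n \<omega>)"
    and i: "i \<in> {1..n - 1}"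
  shows "(deriv ^^ (2 * i + 1)) (\<omega> i (int i)) z = (if i = n - 1 then poly pd z else 0)
    + (\<Sum>k\<le>min i (n - 2). \<Sum>J=k..i. of_rat (struct_const n i J k) *
         (deriv ^^ (i - J)) (\<lambda>z. poly p z * (deriv ^^ (J - k)) (\<omega> (n - 1 - k) (int (n - 1 - k))) z) z)"
proof -
  define T where "T J k = (\<lambda>z. poly p z * (deriv ^^ (J - k)) (\<omega> (n - 1 - k) (int (n - 1 - k))) z)" for J k
  define c where "c J k = (of_rat (struct_const n i J k) :: complex)" for J k
  \<comment> \<open>The value 0 beyond the bottom of the string lets the recursion include its last
    step, where nothing comes from below.\<close>
  define x where "x t = (if t \<le> 2 * i then \<omega> i (int i - int t) else (\<lambda>_. 0))" for t
  define H where "H J = (\<lambda>z. \<Sum>k\<le>min J (n - 2). c J k * T J k z)" for J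
  define d where "d t z = (if i = n - 1 \<and> t = 2 * i then poly pd z else 0)" for t z
  define G where "G t = (\<lambda>z. d t z + (if i \<le> t then H (t - i) z else 0))" for t
  have g_hol: "(deriv ^^ m) (\<omega> (n - 1 - k) (int (n - 1 - k))) holomorphic_on UNIV" if "k \<le> n - 2" for k m
    using that n by (intro holomorphic_higher_deriv hol) auto
  have T_hol: "T J k holomorphic_on UNIV" if "k \<le> n - 2" for J k
    unfolding T_def using that by (intro holomorphic_on_mult g_hol holomorphic_intros)
  have cT_hol: "(\<lambda>z. c J k * T J k z) holomorphic_on UNIV" if "k \<le> n - 2" for J k
    using T_hol[OF that] by (intro holomorphic_intros)
  have H_hol: "H J holomorphic_on UNIV" for J
    unfolding H_def by (intro holomorphic_on_sum cT_hol) auto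
  have d_hol: "d t holomorphic_on UNIV" for t
  proof -
    have "d t = poly pd \<or> d t = (\<lambda>_. 0)" by (auto simp: d_def fun_eq_iff)
    then show ?thesis by (auto intro!: holomorphic_intros)
  qed
  have G_hol: "G t holomorphic_on UNIV" for t
    unfolding G_def using H_hol[of "t - i"] d_hol[of t] by (cases "i \<le> t") (auto intro!: holomorphic_intros)
  have "(deriv ^^ (2 * i + 1)) (x 0) z
      = x (2 * i + 1) z + (\<Sum>t<2 * i + 1. (deriv ^^ (2 * i + 1 - 1 - t)) (G t) z)"
  proof (rule higher_deriv_recursion)
    fix t assume "t \<le> 2 * i + 1"
    then show "x t holomorphic_on UNIV" unfolding x_def using i by (auto intro!: hol)
  next
    fix t z assume t: "t < 2 * i + 1"
    have "(\<Sum>k\<le>min (t - i) (n - 2). of_rat (struct_const n i (t - i) k) * \<omega> (n - 1 - k) (int n - 1 + (int i - int t)) z)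
        = (\<Sum>k\<le>min (t - i) (n - 2). c (t - i) k * (deriv ^^ (t - i - k)) (\<omega> (n - 1 - k) (int (n - 1 - k))) z)"
      if "i \<le> t"
    proof (intro sum.cong refl)
      fix k assume k: "k \<in> {..min (t - i) (n - 2)}"
      \<comment> \<open>The coefficient of weight n - 1 - J in the string n - 1 - k is the (J -
        k)-th derivative of its top coefficient, here with J = t - i.\<close>
      have "(deriv ^^ (t - i - k)) (\<omega> (n - 1 - k) (int (n - 1 - k))) = \<omega> (n - 1 - k) (int (n - 1 - k) - int (t - i - k))"
        using k n t i by (intro omega_higher_deriv[OF n hol sol]) auto
      also have "int (n - 1 - k) - int (t - i - k) = int n - 1 + (int i - int t)"
        using k n that by auto
      finally show "of_rat (struct_const n i (t - i) k) * \<omega> (n - 1 - k) (int n - 1 + (int i - int t)) z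
          = c (t - i) k * (deriv ^^ (t - i - k)) (\<omega> (n - 1 - k) (int (n - 1 - k))) z"
        by (simp add: c_def)
    qed
    moreover have "(int i - int t \<le> 0) = (i \<le> t)" "nat (- (int i - int t)) = t - i"
      "(i = n - 1 \<and> int i - int t = - int (n - 1)) = (i = n - 1 \<and> t = 2 * i)" by auto
    ultimately show "deriv (x t) z = x (Suc t) z + G t z"
      using t i isomonodromy_coefficients[OF n hol sol, of i "int i - int t" z]
      by (auto simp: x_def G_def d_def H_def T_def string_indices_def sum_distrib_left algebra_simps)
  qed (rule G_hol)
  also have "\<dots> = (\<Sum>t<2 * i + 1. (deriv ^^ (2 * i - t)) (G t) z)" by (simp add: x_def)
  \<comment> \<open>Steps t < i are at positive weight and have no source.\<close>
  also have "\<dots> = (\<Sum>t\<in>{i..2 * i}. (deriv ^^ (2 * i - t)) (G t) z)"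
  proof (rule sum.mono_neutral_right)
    show "\<forall>t\<in>{..<2 * i + 1} - {i..2 * i}. (deriv ^^ (2 * i - t)) (G t) z = 0"
      by (auto simp: G_def d_def)
  qed auto
  also have "\<dots> = (\<Sum>J\<le>i. (deriv ^^ (i - J)) (G (i + J)) z)"
    by (rule sum.reindex_bij_witness[of _ "\<lambda>J. i + J" "\<lambda>t. t - i"]) (auto simp: mult_2)
  also have "\<dots> = (\<Sum>J\<le>i. (deriv ^^ (i - J)) (d (i + J)) z + (\<Sum>k\<le>min J (n - 2). c J k * (deriv ^^ (i - J)) (T J k) z))"
  proof (intro sum.cong refl)
    fix J
    have "(deriv ^^ (i - J)) (G (i + J)) z = (deriv ^^ (i - J)) (d (i + J)) z + (deriv ^^ (i - J)) (H J) z"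
      using d_hol H_hol by (simp add: G_def higher_deriv_add[of _ UNIV])
    also have "(deriv ^^ (i - J)) (H J) z = (\<Sum>k\<le>min J (n - 2). (deriv ^^ (i - J)) (\<lambda>z. c J k * T J k z) z)"
      unfolding H_def by (subst higher_deriv_sum) (auto intro: cT_hol)
    also have "\<dots> = (\<Sum>k\<le>min J (n - 2). c J k * (deriv ^^ (i - J)) (T J k) z)"
      using T_hol by (intro sum.cong refl higher_deriv_cmult[of _ UNIV]) auto
    finally show "(deriv ^^ (i - J)) (G (i + J)) z
        = (deriv ^^ (i - J)) (d (i + J)) z + (\<Sum>k\<le>min J (n - 2). c J k * (deriv ^^ (i - J)) (T J k) z)" .
  qed
  also have "\<dots> = (\<Sum>J\<le>i. (deriv ^^ (i - J)) (d (i + J)) z)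
      + (\<Sum>J\<le>i. \<Sum>k\<le>min J (n - 2). c J k * (deriv ^^ (i - J)) (T J k) z)"
    by (rule sum.distrib)
  \<comment> \<open>The inhomogeneity enters only at the last step t = 2i, so it remains
    undifferentiated.\<close>
  also have "(\<Sum>J\<le>i. (deriv ^^ (i - J)) (d (i + J)) z) = (\<Sum>J\<in>{i}. (deriv ^^ (i - J)) (d (i + J)) z)"
  proof (rule sum.mono_neutral_right)
    show "\<forall>J\<in>{..i} - {i}. (deriv ^^ (i - J)) (d (i + J)) z = 0"
    proof
      fix J assume "J \<in> {..i} - {i}"
      then have "d (i + J) = (\<lambda>_. 0)" by (auto simp: d_def fun_eq_iff)
      then show "(deriv ^^ (i - J)) (d (i + J)) z = 0" by simp
    qed
  qed auto
  also have "\<dots> = (if i = n - 1 then poly pd z else 0)" by (simp add: d_def mult_2)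
  also have "(\<Sum>J\<le>i. \<Sum>k\<le>min J (n - 2). c J k * (deriv ^^ (i - J)) (T J k) z)
      = (\<Sum>J\<le>i. \<Sum>k | k \<in> {..min i (n - 2)} \<and> k \<le> J. c J k * (deriv ^^ (i - J)) (T J k) z)"
    by (intro sum.cong) auto
  also have "\<dots> = (\<Sum>k\<le>min i (n - 2). \<Sum>J | J \<in> {..i} \<and> k \<le> J. c J k * (deriv ^^ (i - J)) (T J k) z)"
    by (rule sum.swap_restrict) auto
  also have "\<dots> = (\<Sum>k\<le>min i (n - 2). \<Sum>J=k..i. c J k * (deriv ^^ (i - J)) (T J k) z)"
    by (intro sum.cong) auto
  finally show ?thesis by (simp add: x_def T_def c_def)
qed

section \<open>Assembly of the weight expressions\<close>

lemma finite_nz_indices [simp]: "finite (nz_indices n i)"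
  by (rule finite_subset[of _ "{..i}"]) (auto simp: nz_indices_def)

text \<open>The enumeration meets every index exactly once; the position l counts from 1, the list
  from 0.\<close>

lemma sum_j_idx:
  "(\<Sum>l=1..m_num n i. h (j_idx n i l)) = (\<Sum>k\<in>nz_indices n i. h k)"
proof -
  define xs where "xs = rev (sorted_list_of_set (nz_indices n i))"
  have xs: "set xs = nz_indices n i" "distinct xs" "length xs = m_num n i"
    by (auto simp: xs_def m_num_def)
  have "(\<Sum>l=1..m_num n i. h (j_idx n i l)) = (\<Sum>l<length xs. h (xs ! l))"
    by (rule sum.reindex_bij_witness[of _ Suc "\<lambda>l. l - 1"]) (auto simp: j_idx_def xs xs_def[symmetric])
  also have "\<dots> = sum_list (map h xs)"
    by (simp add: sum_list_sum_nth atLeast0LessThan)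
  also have "\<dots> = (\<Sum>k\<in>nz_indices n i. h k)"
    using xs by (simp add: sum_list_distinct_conv_sum_set)
  finally show ?thesis .
qed

lemma j_idx_in_nz_indices:
  assumes "l \<in> {1..m_num n i}"
  shows "j_idx n i l \<in> nz_indices n i"
proof -
  have "rev (sorted_list_of_set (nz_indices n i)) ! (l - 1) \<in> set (rev (sorted_list_of_set (nz_indices n i)))"
    using assms by (intro nth_mem) (auto simp: m_num_def)
  then show ?thesis by (simp add: j_idx_def)
qed

text \<open>By \<open>struct_const_pos_multiple\<close> the sign of the leading constant makes all
  constants non-negative and the one at J = k positive, as
  \<open>weight_expr_higher_deriv_sum\<close> demands.\<close>

lemma struct_const_sum_weight_expr:
  assumes k: "k \<le> i" "i \<le> n - 1" "k \<noteq> n - 1" and nz: "struct_const n i k k \<noteq> 0"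
    and f: "f holomorphic_on UNIV" and g: "g holomorphic_on UNIV"
  shows "weight_expr (i - k) f g (\<lambda>z. of_rat (sgn (struct_const n i k k)) *
     (\<Sum>J=k..i. of_rat (struct_const n i J k) * (deriv ^^ (i - J)) (\<lambda>z. f z * (deriv ^^ (J - k)) g z) z))"
proof -
  let ?s = "sgn (struct_const n i k k)"
  define a where "a J = real_of_rat (?s * struct_const n i J k)" for J
  have "?s * struct_const n i J k \<ge> 0 \<and> (J = k \<longrightarrow> ?s * struct_const n i J k > 0)" if J: "J \<in> {k..i}" for J
  proof -
    obtain q where q: "q > 0" "struct_const n i J k = q * struct_const n i k k"
      using struct_const_pos_multiple[of k J i n] J k by auto
    have e: "?s * struct_const n i J k = q * \<bar>struct_const n i k k\<bar>"
      unfolding q(2) by (simp add: abs_sgn)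
    show ?thesis unfolding e using q(1) nz by simp
  qed
  then have "weight_expr (i - k) f g
     (\<lambda>z. \<Sum>J=k..i. of_real (a J) * (deriv ^^ (i - J)) (\<lambda>z. f z * (deriv ^^ (J - k)) g z) z)"
    using k by (intro weight_expr_higher_deriv_sum f g) (auto simp: a_def)
  moreover have "of_real (a J) = (of_rat ?s * of_rat (struct_const n i J k) :: complex)" for J
  proof -
    have "of_real (of_rat q) = (of_rat q :: complex)" for q
      by (cases q) (simp add: of_rat_rat)
    then show ?thesis unfolding a_def by (simp add: of_rat_mult)
  qed
  ultimately show ?thesis by (simp add: sum_distrib_left mult.assoc)
qed

theorem proposition6p1:
  fixes n \<kappa> :: nat
    and p pd :: "complex poly"
    and \<omega> :: "nat \<Rightarrow> int \<Rightarrow> complex \<Rightarrow> complex"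
  assumes "n \<ge> 2" and "\<kappa> \<ge> 1" and "degree p = \<kappa> * n" and "degree pd < degree p - 1"
    and "\<And>i j. i \<in> {1..n - 1} \<Longrightarrow> j \<in> {- int i..int i} \<Longrightarrow> \<omega> i j holomorphic_on UNIV"
    and "isomonodromy_solution n p pd (Omega_mat n \<omega>)"
  shows
    "(\<forall>i\<in>{1..n - 2}. m_num n i \<le> i \<and>
        (\<exists>W s. (\<forall>l\<in>{1..m_num n i}.
              weight_expr (i - j_idx n i l) (poly p)
                (\<omega> (n - 1 - j_idx n i l) (int (n - 1 - j_idx n i l))) (W l)
              \<and> s l \<in> {1, - 1 :: complex})
          \<and> (\<forall>z. (deriv ^^ (2 * i + 1)) (\<omega> i (int i)) z = (\<Sum>l = 1..m_num n i. s l * W l z))))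
     \<and> m_num n (n - 1) \<ge> 1 \<and> j_idx n (n - 1) 1 = n - 2
     \<and> (\<exists>W\<^sub>1 W s. weight_expr 1 (poly p) (\<omega> 1 1) W\<^sub>1
          \<and> (\<forall>l\<in>{2..m_num n (n - 1)}.
              weight_expr (n - 1 - j_idx n (n - 1) l) (poly p)
                (\<omega> (n - 1 - j_idx n (n - 1) l) (int (n - 1 - j_idx n (n - 1) l))) (W l)
              \<and> s l \<in> {1, - 1 :: complex})
          \<and> (\<forall>z. (deriv ^^ (2 * n - 1)) (\<omega> (n - 1) (int (n - 1))) z =
                poly pd z + W\<^sub>1 z + (\<Sum>l = 2..m_num n (n - 1). s l * W l z)))"
proof -
  note n = assms(1) and hol = assms(5) and sol = assms(6)
  define c where "c i k = struct_const n i k k" for i k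
  define g where "g k = \<omega> (n - 1 - k) (int (n - 1 - k))" for k
  define T where "T i k = (\<lambda>z. \<Sum>J=k..i. of_rat (struct_const n i J k) *
         (deriv ^^ (i - J)) (\<lambda>z. poly p z * (deriv ^^ (J - k)) (g k) z) z)" for i k
  define s where "s i k = (of_rat (sgn (c i k)) :: complex)" for i k
  \<comment> \<open>The contribution T times its sign. Since the sign squares to 1 on
    \<open>nz_indices n i\<close>, T is recovered as \<open>s\<close> times
    \<open>W\<close>.\<close>
  define W where "W i k = (\<lambda>z. s i k * T i k z)" for i k
  have W: "weight_expr (i - k) (poly p) (g k) (W i k)" if "i \<in> {1..n - 1}" "k \<in> nz_indices n i" for i k
    unfolding W_def s_def c_def T_def
  proof (rule struct_const_sum_weight_expr)
    show "g k holomorphic_on UNIV" unfolding g_def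
      using that n by (intro hol) (auto simp: nz_indices_def)
  qed (use that n in \<open>auto simp: nz_indices_def intro!: holomorphic_intros\<close>)
  have s: "s i k \<in> {1, - 1}" and sW: "s i k * W i k z = T i k z" if "k \<in> nz_indices n i" for i k z
  proof -
    have "s i k = 1 \<or> s i k = - 1"
      using that by (auto simp: s_def c_def nz_indices_def sgn_if of_rat_minus)
    then show "s i k \<in> {1, - 1}" "s i k * W i k z = T i k z" by (auto simp: W_def)
  qed
  have main: "(deriv ^^ (2 * i + 1)) (\<omega> i (int i)) z
      = (if i = n - 1 then poly pd z else 0) + (\<Sum>l=1..m_num n i. s i (j_idx n i l) * W i (j_idx n i l) z)"
    if i: "i \<in> {1..n - 1}" for i z
  proof -
    have "(\<Sum>k\<le>min i (n - 2). T i k z) = (\<Sum>k\<in>nz_indices n i. T i k z)"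
    proof (rule sum.mono_neutral_right)
      show "\<forall>k\<in>{..min i (n - 2)} - nz_indices n i. T i k z = 0"
      proof
        fix k assume k: "k \<in> {..min i (n - 2)} - nz_indices n i"
        \<comment> \<open>A vanishing leading constant annihilates all the constants that multiply
          it.\<close>
        have "struct_const n i J k = 0" if "J \<in> {k..i}" for J
          using struct_const_pos_multiple[of k J i n] k that i n by (auto simp: nz_indices_def)
        then show "T i k z = 0" by (simp add: T_def)
      qed
    qed (auto simp: nz_indices_def)
    also have "\<dots> = (\<Sum>k\<in>nz_indices n i. s i k * W i k z)" by (simp add: sW)
    also have "\<dots> = (\<Sum>l=1..m_num n i. s i (j_idx n i l) * W i (j_idx n i l) z)" by (rule sum_j_idx[symmetric])
    finally show ?thesis
      using omega_main[OF n hol sol i, of z] by (simp add: T_def g_def)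
  qed
  have top: "n - 2 \<in> nz_indices n (n - 1)"
    using struct_const_top[OF n] by (simp add: nz_indices_def)
  have m1: "m_num n (n - 1) \<ge> 1"
    using top by (auto simp: m_num_def Suc_le_eq card_gt_0_iff)
  have j1: "j_idx n (n - 1) 1 = n - 2"
  proof -
    let ?S = "nz_indices n (n - 1)"
    \<comment> \<open>n - 2 bounds all indices, so it stands last in the increasing list and first
      in the reversed one.\<close>
    have "sorted_list_of_set ?S = insort (n - 2) (sorted_list_of_set (?S - {n - 2}))"
      using sorted_list_of_set.sorted_key_list_of_set_insert_remove[OF finite_nz_indices, of "n - 2" n "n - 1"]
      unfolding insert_absorb[OF top] .
    also have "\<dots> = sorted_list_of_set (?S - {n - 2}) @ [n - 2]"
      by (rule sorted_insort_is_snoc) (auto simp: nz_indices_def)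
    finally have "sorted_list_of_set ?S = sorted_list_of_set (?S - {n - 2}) @ [n - 2]" .
    then show ?thesis by (simp add: j_idx_def)
  qed
  have "m_num n i \<le> i" if i: "i \<in> {1..n - 2}" for i
  proof -
    \<comment> \<open>Excluding j = i leaves at most the i values below i.\<close>
    have "i \<notin> nz_indices n i" using struct_const_diag_zero[of i n] i by (simp add: nz_indices_def)
    then have "nz_indices n i \<subseteq> {..<i}" by (auto simp: nz_indices_def le_less)
    then show ?thesis unfolding m_num_def using card_mono[of "{..<i}"] by simp
  qed
  moreover have "\<exists>W s. (\<forall>l\<in>{1..m_num n i}.
              weight_expr (i - j_idx n i l) (poly p)
                (\<omega> (n - 1 - j_idx n i l) (int (n - 1 - j_idx n i l))) (W l)
              \<and> s l \<in> {1, - 1 :: complex})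
          \<and> (\<forall>z. (deriv ^^ (2 * i + 1)) (\<omega> i (int i)) z = (\<Sum>l = 1..m_num n i. s l * W l z))"
    if i: "i \<in> {1..n - 2}" for i
  proof (intro exI[of _ "\<lambda>l. W i (j_idx n i l)"] exI[of _ "\<lambda>l. s i (j_idx n i l)"] conjI ballI allI)
    fix l assume "l \<in> {1..m_num n i}"
    then have l: "j_idx n i l \<in> nz_indices n i" by (rule j_idx_in_nz_indices)
    show "weight_expr (i - j_idx n i l) (poly p)
                (\<omega> (n - 1 - j_idx n i l) (int (n - 1 - j_idx n i l))) (W i (j_idx n i l))"
      using W[OF _ l] i unfolding g_def by auto
    show "s i (j_idx n i l) \<in> {1, - 1}" by (rule s[OF l])
  next
    fix z
    have "i \<in> {1..n - 1}" "i \<noteq> n - 1" using i by auto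
    then show "(deriv ^^ (2 * i + 1)) (\<omega> i (int i)) z
        = (\<Sum>l = 1..m_num n i. s i (j_idx n i l) * W i (j_idx n i l) z)"
      using main[of i z] by simp
  qed
  moreover have "\<exists>W\<^sub>1 W s. weight_expr 1 (poly p) (\<omega> 1 1) W\<^sub>1
          \<and> (\<forall>l\<in>{2..m_num n (n - 1)}.
              weight_expr (n - 1 - j_idx n (n - 1) l) (poly p)
                (\<omega> (n - 1 - j_idx n (n - 1) l) (int (n - 1 - j_idx n (n - 1) l))) (W l)
              \<and> s l \<in> {1, - 1 :: complex})
          \<and> (\<forall>z. (deriv ^^ (2 * n - 1)) (\<omega> (n - 1) (int (n - 1))) z =
                poly pd z + W\<^sub>1 z + (\<Sum>l = 2..m_num n (n - 1). s l * W l z))"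
  proof (intro exI[of _ "W (n - 1) (n - 2)"] exI[of _ "\<lambda>l. W (n - 1) (j_idx n (n - 1) l)"]
      exI[of _ "\<lambda>l. s (n - 1) (j_idx n (n - 1) l)"] conjI ballI allI)
    have i: "n - 1 \<in> {1..n - 1}" using n by auto
    have "n - 1 - (n - 2) = 1" using n by auto
    then show "weight_expr 1 (poly p) (\<omega> 1 1) (W (n - 1) (n - 2))"
      using W[OF i top] by (simp add: g_def)
    {
      fix l assume "l \<in> {2..m_num n (n - 1)}"
      then have l: "j_idx n (n - 1) l \<in> nz_indices n (n - 1)" by (intro j_idx_in_nz_indices) auto
      show "weight_expr (n - 1 - j_idx n (n - 1) l) (poly p)
                  (\<omega> (n - 1 - j_idx n (n - 1) l) (int (n - 1 - j_idx n (n - 1) l))) (W (n - 1) (j_idx n (n - 1) l))"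
        using W[OF i l] unfolding g_def .
      show "s (n - 1) (j_idx n (n - 1) l) \<in> {1, - 1}" by (rule s[OF l])
    next
      fix z
      have "(\<Sum>l=1..m_num n (n - 1). s (n - 1) (j_idx n (n - 1) l) * W (n - 1) (j_idx n (n - 1) l) z)
          = s (n - 1) (n - 2) * W (n - 1) (n - 2) z
            + (\<Sum>l=2..m_num n (n - 1). s (n - 1) (j_idx n (n - 1) l) * W (n - 1) (j_idx n (n - 1) l) z)"
        using j1 by (subst sum.atLeast_Suc_atMost[OF m1]) (simp add: numeral_2_eq_2)
      \<comment> \<open>The leading constant is 2, so the first term carries no sign choice.\<close>
      moreover have "s (n - 1) (n - 2) = 1" by (simp only: s_def c_def struct_const_top[OF n]) simp
      moreover have "2 * (n - 1) + 1 = 2 * n - 1" using n by auto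
      ultimately show "(deriv ^^ (2 * n - 1)) (\<omega> (n - 1) (int (n - 1))) z = poly pd z + W (n - 1) (n - 2) z
            + (\<Sum>l=2..m_num n (n - 1). s (n - 1) (j_idx n (n - 1) l) * W (n - 1) (j_idx n (n - 1) l) z)"
        using main[OF i, of z] by simp
    }
  qed
  ultimately show ?thesis using m1 j1 by blast
qed

end
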